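(* Let $0<k<n$ and let $(c_{lj})_{1\le j,l\le k-1}$ be a real anti-symmetric matrix. Equip $\mathbb{C}^{n+1}$ (coordinates $z_0,\dots,z_n$) with the toric generalized Kähler structure associated to the standard Kähler structure and $C=\frac12\sum_{j,l=1}^{k-1}c_{lj}\,e_j\wedge e_l$, and let $\mathbb{C}P^n$ carry the generalized Kähler structure of symplectic type obtained from it by generalized Kähler reduction by the diagonal $S^1$-action; its symplectic form is the Fubini–Study form $\Omega$. Let $U(n+1-k)\subset U(n+1)$ act on $\mathbb{C}^{n+1}=\mathbb{C}^k\oplus\mathbb{C}^{n+1-k}$ by fixing $\mathbb{C}^k$ (coordinates $z_0,\dots,z_{k-1}$) and acting in the standard way on $\mathbb{C}^{n+1-k}$ (coordinates $z_k,\dots,z_n$), and consider the induced action on $\mathbb{C}P^n$, which preserves its generalized Kähler structure and is Hamiltonian with respect to $\Omega$. Then this $U(n+1-k)$-action on the generalized Kähler manifold $\mathbb{C}P^n$ is strong Hamiltonian.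
   Context: Generalized Kähler (GK) structures of symplectic type. On a symplectic manifold $(M,\Omega)$ they are parametrized by integrable complex structures $J_+$ tamed by $\Omega$ ($\Omega(X,J_+X)>0$ for $X\ne0$) with $J_-:=-\Omega^{-1}J_+^*\Omega$ integrable; here 2-forms and metrics are maps $X\mapsto\iota_X(\cdot)$, and $(J^*\alpha)(X)=\alpha(JX)$. Put $g=-\frac12\Omega(J_++J_-)$, $b=-\frac12\Omega(J_+-J_-)$, $\omega_\pm=gJ_\pm$; the GK structure on $TM\oplus T^*M$ (in the metric splitting) is $$\mathbb{J}_{1}=\frac12\begin{pmatrix}-J_+- J_-&\omega_+^{-1}-\omega_-^{-1}\\-\omega_++\omega_-&J_+^*+ J_-^*\end{pmatrix},\quad \mathbb{J}_{2}=\frac12\begin{pmatrix}-J_++ J_-&\omega_+^{-1}+\omega_-^{-1}\\-\omega_+-\omega_-&J_+^*- J_-^*\end{pmatrix},$$ and the Poisson structure associated to $\mathbb{J}_1$ is $\beta_1=-\frac12(J_+-J_-)g^{-1}$. Strong Hamiltonian. If a compact group $K$ acts on $M$ preserving $J_+$ and Hamiltonian with respect to $\Omega$ with moment map $\mu$ ($\iota_{X_\varsigma}\Omega=-d\mu_\varsigma$ for $\varsigma\in\mathfrak k$), the action is strong Hamiltonian if $\beta_1(d\mu_\varsigma,d\mu_\zeta)=0$ for all $\varsigma,\zeta\in\mathfrak k$. Structure on $\mathbb{C}^{n+1}$. Let $\{e_0,\dots,e_n\}$ be the standard basis of the Lie algebra $\mathbb{R}^{n+1}$ of $\mathbb{T}^{n+1}$,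 acting diagonally on $\mathbb{C}^{n+1}$ with $\Omega_0=\frac{\sqrt{-1}}2\sum dz_j\wedge d\bar z_j$, $z_j=|z_j|e^{\sqrt{-1}\theta_j}$, $\nu_j=\frac12|z_j|^2$. The GK structure associated to $C$ is the $J_+$ on $\mathbb{C}^{n+1}$ which on $(\mathbb{C}^* )^{n+1}$ is $J_+\partial_{\nu_l}=\sum_j\phi_{lj}\partial_{\theta_j}$, with $\phi=\mathrm{diag}(1/|z_0|^2,\dots,1/|z_n|^2)+(c_{lj})$ ($c_{lj}$ extended by zero to all indices $0,\dots,n$). GK reduction by $S^1$. Let $Z=\{|z|^2=1\}$, $\mathbb{C}P^n=Z/S^1$, $X$ the generator of the diagonal action, $f=\frac12|z|^2$. Over $Z$ let $\hat{\mathbb K}=\mathrm{span}\{X-b(X),df\}$. The reduced GK structure lives on $(\hat{\mathbb K}^\perp/\hat{\mathbb K})/S^1$ ($\perp$ with respect to the natural pairing on $T\oplus T^*$) and has $\sqrt{-1}$-eigenbundles $\big((L_i\cap\hat{\mathbb K}^\perp_{\mathbb C}+\hat{\mathbb K}_{\mathbb C})/\hat{\mathbb K}_{\mathbb C}\big)/S^1$, where $L_i$ is the $\sqrt{-1}$-eigenbundle of $\mathbb{J}_i$ on $\mathbb{C}^{n+1}$. *)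

theory Defs
  imports "HOL-Analysis.Analysis"
begin

section \<open>Smooth maps on open subsets of a normed space\<close>

primrec Ck_on :: "nat \<Rightarrow> 'a::real_normed_vector set \<Rightarrow> ('a \<Rightarrow> 'b::real_normed_vector) \<Rightarrow> bool" where
  "Ck_on 0 U f \<longleftrightarrow> continuous_on U f"
| "Ck_on (Suc m) U f \<longleftrightarrow>
     f differentiable_on U \<and> (\<forall>v. Ck_on m U (\<lambda>x. frechet_derivative f (at x) v))"

definition smooth_on :: "'a::real_normed_vector set \<Rightarrow> ('a \<Rightarrow> 'b::real_normed_vector) \<Rightarrow> bool" where
  "smooth_on U f \<longleftrightarrow> open U \<and> (\<forall>m. Ck_on m U f)"

section \<open>Manifolds presented as a quotient of a submanifold of a vector space\<close>

text \<open>
  A manifold \<open>M = N/G\<close> is given by a submanifold \<open>N\<close> of a Euclidean space (\<open>pts\<close>), its tangent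
  spaces (\<open>tang\<close>), a group \<open>G\<close> of linear maps acting freely on \<open>N\<close> (\<open>grp\<close>), and the tangent
  spaces of the \<open>G\<close>-orbits (\<open>vert\<close>).  The points of \<open>M\<close> are the orbits, and \<open>TM = (TN/vert)/G\<close>:
  a tangent vector of \<open>M\<close> at the orbit of \<open>z\<close> is represented by an element of \<open>tang M z\<close>,
  modulo \<open>vert M z\<close>; a covector by a linear form vanishing on \<open>vert M z\<close>, of which only the
  values on \<open>tang M z\<close> count.  The only two instances are \<open>\<complex>\<^sup>n\<^sup>+\<^sup>1\<close> with trivial group and
  \<open>\<complex>P\<^sup>n = S\<^sup>2\<^sup>n\<^sup>+\<^sup>1/S\<^sup>1\<close>, below.
\<close>

record 'v qman =
  pts :: "'v set"
  tang :: "'v \<Rightarrow> 'v set"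
  vert :: "'v \<Rightarrow> 'v set"
  grp :: "('v \<Rightarrow> 'v) set"

definition orbit_of :: "'v qman \<Rightarrow> 'v \<Rightarrow> 'v set" where
  "orbit_of M z = (\<lambda>h. h z) ` grp M"

definition vfield :: "'v::euclidean_space qman \<Rightarrow> ('v \<Rightarrow> 'v) \<Rightarrow> bool" where
  "vfield M Y \<longleftrightarrow>
     (\<exists>U. pts M \<subseteq> U \<and> smooth_on U Y) \<and>
     (\<forall>z\<in>pts M. Y z \<in> tang M z) \<and>
     (\<forall>h\<in>grp M. \<forall>z\<in>pts M. Y (h z) - h (Y z) \<in> vert M (h z))"

definition lie_bracket :: "('v::euclidean_space \<Rightarrow> 'v) \<Rightarrow> ('v \<Rightarrow> 'v) \<Rightarrow> 'v \<Rightarrow> 'v" where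
  "lie_bracket Y W z = frechet_derivative W (at z) (Y z) - frechet_derivative Y (at z) (W z)"

definition endo_field :: "'v::euclidean_space qman \<Rightarrow> ('v \<Rightarrow> 'v \<Rightarrow>\<^sub>L 'v) \<Rightarrow> bool" where
  "endo_field M J \<longleftrightarrow>
     (\<forall>z\<in>pts M. J z ` tang M z \<subseteq> tang M z \<and> J z ` vert M z \<subseteq> vert M z) \<and>
     (\<forall>h\<in>grp M. \<forall>z\<in>pts M. \<forall>v\<in>tang M z. J (h z) (h v) - h (J z v) \<in> vert M (h z)) \<and>
     (\<forall>Y. vfield M Y \<longrightarrow> (\<exists>Y'. vfield M Y' \<and> (\<forall>z\<in>pts M. Y' z - J z (Y z) \<in> vert M z)))"

text \<open>Vanishing of the Nijenhuis tensor; \<open>Y'\<close> and \<open>W'\<close> represent \<open>J Y\<close> and \<open>J W\<close>.\<close>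

definition integrable_endo :: "'v::euclidean_space qman \<Rightarrow> ('v \<Rightarrow> 'v \<Rightarrow>\<^sub>L 'v) \<Rightarrow> bool" where
  "integrable_endo M J \<longleftrightarrow>
     (\<forall>Y W Y' W'. vfield M Y \<and> vfield M W \<and> vfield M Y' \<and> vfield M W' \<and>
        (\<forall>z\<in>pts M. Y' z - J z (Y z) \<in> vert M z) \<and>
        (\<forall>z\<in>pts M. W' z - J z (W z) \<in> vert M z) \<longrightarrow>
        (\<forall>z\<in>pts M.
           lie_bracket Y' W' z - J z (lie_bracket Y' W z) - J z (lie_bracket Y W' z)
             - lie_bracket Y W z \<in> vert M z))"

definition complex_structure :: "'v::euclidean_space qman \<Rightarrow> ('v \<Rightarrow> 'v \<Rightarrow>\<^sub>L 'v) \<Rightarrow> bool" where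
  "complex_structure M J \<longleftrightarrow>
     endo_field M J \<and> (\<forall>z\<in>pts M. \<forall>v\<in>tang M z. J z (J z v) + v \<in> vert M z) \<and>
     integrable_endo M J"

text \<open>Functions on \<open>M\<close> have the set of orbits as domain.  \<open>lifts M F f\<close>: \<open>f\<close> is a smooth function
  near \<open>N\<close> which restricts to the pullback of \<open>F\<close> to \<open>N\<close>.  The covector \<open>dfun M F z\<close> is well
  defined on \<open>tang M z\<close>, where it does not depend on the choice of \<open>f\<close>.\<close>

definition lifts :: "'v::euclidean_space qman \<Rightarrow> ('v set \<Rightarrow> real) \<Rightarrow> ('v \<Rightarrow> real) \<Rightarrow> bool" where
  "lifts M F f \<longleftrightarrow>
     (\<exists>U. pts M \<subseteq> U \<and> smooth_on U f) \<and> (\<forall>z\<in>pts M. f z = F (orbit_of M z))"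

definition smooth_fun :: "'v::euclidean_space qman \<Rightarrow> ('v set \<Rightarrow> real) \<Rightarrow> bool" where
  "smooth_fun M F \<longleftrightarrow> (\<exists>f. lifts M F f)"

definition dfun :: "'v::euclidean_space qman \<Rightarrow> ('v set \<Rightarrow> real) \<Rightarrow> 'v \<Rightarrow> 'v \<Rightarrow>\<^sub>L real" where
  "dfun M F z = Blinfun (frechet_derivative (SOME f. lifts M F f) (at z))"

section \<open>Generalized Kaehler structures of symplectic type\<close>

text \<open>
  Pointwise data: \<open>S = tang M z\<close>, \<open>R = vert M z\<close>, the form \<open>\<Omega>\<close> as the map \<open>x \<mapsto> \<iota>\<^sub>x\<Omega>\<close>, and \<open>J = J\<^sub>+\<close>.
  All vectors are meant modulo \<open>R\<close>, all covectors up to equality on \<open>S\<close>.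
  \<open>sharp S h\<close> is the inverse of the map \<open>h\<close> from tangent vectors to covectors.
\<close>

definition sharp :: "'v::euclidean_space set \<Rightarrow> ('v \<Rightarrow> 'v \<Rightarrow>\<^sub>L real) \<Rightarrow> ('v \<Rightarrow>\<^sub>L real) \<Rightarrow> 'v" where
  "sharp S h \<alpha> = (SOME x. x \<in> S \<and> (\<forall>y\<in>S. h x y = \<alpha> y))"

text \<open>\<open>J\<^sub>- = - \<Omega>\<^sup>-\<^sup>1 J\<^sub>+\<^sup>* \<Omega>\<close>, where \<open>J\<^sup>* \<alpha> = \<alpha> \<circ> J\<close>.\<close>

definition Jminus :: "'v::euclidean_space set \<Rightarrow> ('v \<Rightarrow> 'v \<Rightarrow>\<^sub>L real) \<Rightarrow> ('v \<Rightarrow>\<^sub>L 'v) \<Rightarrow> 'v \<Rightarrow>\<^sub>L 'v" where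
  "Jminus S \<Omega> J =
     (SOME J' :: 'v \<Rightarrow>\<^sub>L 'v. J' ` S \<subseteq> S \<and> (\<forall>x\<in>S. \<forall>y\<in>S. \<Omega> (J' x) y = - (\<Omega> x o\<^sub>L J) y))"

definition gmet :: "'v::euclidean_space set \<Rightarrow> ('v \<Rightarrow> 'v \<Rightarrow>\<^sub>L real) \<Rightarrow> ('v \<Rightarrow>\<^sub>L 'v) \<Rightarrow> 'v \<Rightarrow> 'v \<Rightarrow>\<^sub>L real" where
  "gmet S \<Omega> J x = - (1/2) *\<^sub>R \<Omega> (J x + Jminus S \<Omega> J x)"

definition bfield :: "'v::euclidean_space set \<Rightarrow> ('v \<Rightarrow> 'v \<Rightarrow>\<^sub>L real) \<Rightarrow> ('v \<Rightarrow>\<^sub>L 'v) \<Rightarrow> 'v \<Rightarrow> 'v \<Rightarrow>\<^sub>L real" where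
  "bfield S \<Omega> J x = - (1/2) *\<^sub>R \<Omega> (J x - Jminus S \<Omega> J x)"

definition omega_plus :: "'v::euclidean_space set \<Rightarrow> ('v \<Rightarrow> 'v \<Rightarrow>\<^sub>L real) \<Rightarrow> ('v \<Rightarrow>\<^sub>L 'v) \<Rightarrow> 'v \<Rightarrow> 'v \<Rightarrow>\<^sub>L real" where
  "omega_plus S \<Omega> J x = gmet S \<Omega> J (J x)"

definition omega_minus :: "'v::euclidean_space set \<Rightarrow> ('v \<Rightarrow> 'v \<Rightarrow>\<^sub>L real) \<Rightarrow> ('v \<Rightarrow>\<^sub>L 'v) \<Rightarrow> 'v \<Rightarrow> 'v \<Rightarrow>\<^sub>L real" where
  "omega_minus S \<Omega> J x = gmet S \<Omega> J (Jminus S \<Omega> J x)"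

type_synonym 'v gvec = "'v \<times> ('v \<Rightarrow>\<^sub>L real)"

definition GJ1 :: "'v::euclidean_space set \<Rightarrow> ('v \<Rightarrow> 'v \<Rightarrow>\<^sub>L real) \<Rightarrow> ('v \<Rightarrow>\<^sub>L 'v) \<Rightarrow> 'v gvec \<Rightarrow> 'v gvec" where
  "GJ1 S \<Omega> J e =
     (let x = fst e; \<alpha> = snd e;
          \<omega> = omega_plus S \<Omega> J; \<omega>' = omega_minus S \<Omega> J
      in (1/2) *\<^sub>R (- J x - Jminus S \<Omega> J x + sharp S \<omega> \<alpha> - sharp S \<omega>' \<alpha>,
                   - \<omega> x + \<omega>' x + (\<alpha> o\<^sub>L J) + (\<alpha> o\<^sub>L Jminus S \<Omega> J)))"

definition GJ2 :: "'v::euclidean_space set \<Rightarrow> ('v \<Rightarrow> 'v \<Rightarrow>\<^sub>L real) \<Rightarrow> ('v \<Rightarrow>\<^sub>L 'v) \<Rightarrow> 'v gvec \<Rightarrow> 'v gvec" where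
  "GJ2 S \<Omega> J e =
     (let x = fst e; \<alpha> = snd e;
          \<omega> = omega_plus S \<Omega> J; \<omega>' = omega_minus S \<Omega> J
      in (1/2) *\<^sub>R (- J x + Jminus S \<Omega> J x + sharp S \<omega> \<alpha> + sharp S \<omega>' \<alpha>,
                   - \<omega> x - \<omega>' x + (\<alpha> o\<^sub>L J) - (\<alpha> o\<^sub>L Jminus S \<Omega> J)))"

text \<open>The Poisson structure \<open>\<beta>\<^sub>1 = - (J\<^sub>+ - J\<^sub>-) g\<^sup>-\<^sup>1 / 2\<close>, as a map and as a bivector.\<close>

definition beta1 :: "'v::euclidean_space set \<Rightarrow> ('v \<Rightarrow> 'v \<Rightarrow>\<^sub>L real) \<Rightarrow> ('v \<Rightarrow>\<^sub>L 'v) \<Rightarrow> ('v \<Rightarrow>\<^sub>L real) \<Rightarrow> 'v" where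
  "beta1 S \<Omega> J \<alpha> =
     (let x = sharp S (gmet S \<Omega> J) \<alpha> in - (1/2) *\<^sub>R (J x - Jminus S \<Omega> J x))"

definition poisson1 ::
  "'v::euclidean_space set \<Rightarrow> ('v \<Rightarrow> 'v \<Rightarrow>\<^sub>L real) \<Rightarrow> ('v \<Rightarrow>\<^sub>L 'v) \<Rightarrow> ('v \<Rightarrow>\<^sub>L real) \<Rightarrow> ('v \<Rightarrow>\<^sub>L real) \<Rightarrow> real" where
  "poisson1 S \<Omega> J \<alpha> \<gamma> = \<gamma> (beta1 S \<Omega> J \<alpha>)"

definition gk_symplectic ::
  "'v::euclidean_space qman \<Rightarrow> ('v \<Rightarrow> 'v \<Rightarrow> 'v \<Rightarrow>\<^sub>L real) \<Rightarrow> ('v \<Rightarrow> 'v \<Rightarrow>\<^sub>L 'v) \<Rightarrow> bool" where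
  "gk_symplectic M \<Omega> J \<longleftrightarrow>
     complex_structure M J \<and>
     (\<forall>z\<in>pts M. \<forall>v \<in> tang M z - vert M z. \<Omega> z v (J z v) > 0) \<and>
     complex_structure M (\<lambda>z. Jminus (tang M z) (\<Omega> z) (J z))"

text \<open>The fibre of \<open>TM \<oplus> T\<^sup>*M\<close>, equality in it, the natural pairing, and the \<open>\<i>\<close>-eigenbundle of an
  endomorphism.  An element \<open>a + \<i> b\<close> of a complexification is written as the pair \<open>(a, b)\<close>.\<close>

definition gtan :: "'v::euclidean_space set \<Rightarrow> 'v set \<Rightarrow> 'v gvec set" where
  "gtan S R = {e :: 'v gvec. fst e \<in> S \<and> (\<forall>r\<in>R. snd e r = 0)}"

definition gt_eq :: "'v::euclidean_space set \<Rightarrow> 'v set \<Rightarrow> 'v gvec \<Rightarrow> 'v gvec \<Rightarrow> bool" where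
  "gt_eq S R e e' \<longleftrightarrow> fst e - fst e' \<in> R \<and> (\<forall>y\<in>S. snd e y = snd e' y)"

definition pairing :: "'v::euclidean_space gvec \<Rightarrow> 'v gvec \<Rightarrow> real" where
  "pairing e e' = (snd e (fst e') + snd e' (fst e)) / 2"

definition eigenbundle ::
  "'v::euclidean_space set \<Rightarrow> 'v set \<Rightarrow> ('v gvec \<Rightarrow> 'v gvec) \<Rightarrow> ('v gvec \<times> 'v gvec) set" where
  "eigenbundle S R JJ =
     {(a, b). a \<in> gtan S R \<and> b \<in> gtan S R \<and> gt_eq S R (JJ a) (- b) \<and> gt_eq S R (JJ b) a}"

section \<open>Strong Hamiltonian actions\<close>

definition compact_matrix_group :: "(complex^'n^'n) set \<Rightarrow> bool" where
  "compact_matrix_group K \<longleftrightarrow>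
     compact K \<and> mat 1 \<in> K \<and> (\<forall>A\<in>K. \<forall>B\<in>K. A ** B \<in> K) \<and> (\<forall>A\<in>K. invertible A \<and> matrix_inv A \<in> K)"

definition lie_alg :: "(complex^'n^'n) set \<Rightarrow> (complex^'n^'n) set" where
  "lie_alg K =
     {\<sigma>. \<exists>\<gamma>. (\<forall>t::real. \<gamma> t \<in> K) \<and> \<gamma> 0 = mat 1 \<and> (\<gamma> has_vector_derivative \<sigma>) (at 0)}"

text \<open>A matrix group acting linearly on \<open>N\<close> and thereby on \<open>M = N/G\<close>.  The vector field generated
  by \<open>\<sigma>\<close> is represented by \<open>z \<mapsto> \<sigma> z\<close>.\<close>

definition acts_on :: "(complex^'n) qman \<Rightarrow> (complex^'n^'n) set \<Rightarrow> bool" where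
  "acts_on M K \<longleftrightarrow>
     (\<forall>A\<in>K. \<forall>z\<in>pts M. A *v z \<in> pts M \<and> orbit_of M (A *v z) = (\<lambda>w. A *v w) ` orbit_of M z)"

definition preserves_endo ::
  "(complex^'n) qman \<Rightarrow> (complex^'n \<Rightarrow> (complex^'n) \<Rightarrow>\<^sub>L (complex^'n)) \<Rightarrow> (complex^'n^'n) set \<Rightarrow> bool" where
  "preserves_endo M J K \<longleftrightarrow>
     (\<forall>A\<in>K. \<forall>z\<in>pts M. \<forall>v\<in>tang M z. J (A *v z) (A *v v) - A *v J z v \<in> vert M (A *v z))"

definition moment_map ::
  "(complex^'n) qman \<Rightarrow> (complex^'n \<Rightarrow> complex^'n \<Rightarrow> (complex^'n) \<Rightarrow>\<^sub>L real) \<Rightarrow> (complex^'n^'n) set \<Rightarrow>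
   (complex^'n^'n \<Rightarrow> (complex^'n) set \<Rightarrow> real) \<Rightarrow> bool" where
  "moment_map M \<Omega> K \<mu> \<longleftrightarrow>
     (\<forall>\<sigma>\<in>lie_alg K. \<forall>\<tau>\<in>lie_alg K. \<forall>s t. \<forall>z\<in>pts M.
        \<mu> (s *\<^sub>R \<sigma> + t *\<^sub>R \<tau>) (orbit_of M z) = s * \<mu> \<sigma> (orbit_of M z) + t * \<mu> \<tau> (orbit_of M z)) \<and>
     (\<forall>\<sigma>\<in>lie_alg K. smooth_fun M (\<mu> \<sigma>) \<and>
        (\<forall>z\<in>pts M. \<forall>v\<in>tang M z. \<Omega> z (\<sigma> *v z) v = - dfun M (\<mu> \<sigma>) z v))"

definition equivariant_map ::
  "(complex^'n) qman \<Rightarrow> (complex^'n^'n) set \<Rightarrow> (complex^'n^'n \<Rightarrow> (complex^'n) set \<Rightarrow> real) \<Rightarrow> bool" where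
  "equivariant_map M K \<mu> \<longleftrightarrow>
     (\<forall>A\<in>K. \<forall>\<sigma>\<in>lie_alg K. \<forall>z\<in>pts M.
        \<mu> (A ** \<sigma> ** matrix_inv A) (orbit_of M (A *v z)) = \<mu> \<sigma> (orbit_of M z))"

definition strong_hamiltonian ::
  "(complex^'n) qman \<Rightarrow> (complex^'n \<Rightarrow> complex^'n \<Rightarrow> (complex^'n) \<Rightarrow>\<^sub>L real) \<Rightarrow>
   (complex^'n \<Rightarrow> (complex^'n) \<Rightarrow>\<^sub>L (complex^'n)) \<Rightarrow> (complex^'n^'n) set \<Rightarrow> bool" where
  "strong_hamiltonian M \<Omega> J K \<longleftrightarrow>
     compact_matrix_group K \<and> acts_on M K \<and> preserves_endo M J K \<and>
     (\<exists>\<mu>. moment_map M \<Omega> K \<mu> \<and> equivariant_map M K \<mu>) \<and>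
     (\<forall>\<mu>. moment_map M \<Omega> K \<mu> \<longrightarrow>
        (\<forall>\<sigma>\<in>lie_alg K. \<forall>\<tau>\<in>lie_alg K. \<forall>z\<in>pts M.
           poisson1 (tang M z) (\<Omega> z) (J z) (dfun M (\<mu> \<sigma>) z) (dfun M (\<mu> \<tau>) z) = 0))"

section \<open>The toric structure on \<open>\<complex>\<^sup>n\<^sup>+\<^sup>1\<close>\<close>

definition Cspace :: "(complex^'n) qman" where
  "Cspace = \<lparr>pts = UNIV, tang = (\<lambda>_. UNIV), vert = (\<lambda>_. {0}), grp = {id}\<rparr>"

text \<open>\<open>(\<i>/2) \<Sum> dz\<^sub>j \<and> dz\<^sub>j\<^sup>*\<close>; the sum is real, \<open>Re\<close> only adjusts the type.\<close>

definition Omega0 :: "complex^'n \<Rightarrow> (complex^'n) \<Rightarrow>\<^sub>L real" where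
  "Omega0 v = Blinfun (\<lambda>w. Re (\<Sum>j\<in>UNIV. \<i>/2 * (v$j * cnj (w$j) - w$j * cnj (v$j))))"

text \<open>The coordinate fields of the coordinates \<open>(\<nu>\<^sub>j, \<theta>\<^sub>j)\<close> with \<open>z\<^sub>j = sqrt (2 \<nu>\<^sub>j) exp (\<i> \<theta>\<^sub>j)\<close>.\<close>

definition d_theta :: "complex^'n \<Rightarrow> 'n \<Rightarrow> complex^'n" where
  "d_theta z j = axis j (\<i> * z$j)"

definition d_nu :: "complex^'n \<Rightarrow> 'n \<Rightarrow> complex^'n" where
  "d_nu z j = axis j (z$j / of_real ((cmod (z$j))\<^sup>2))"

text \<open>The coordinates \<open>0, \<dots>, n\<close> are the \<open>label\<close>s of the elements of the index type, and
  \<open>c l j\<close> only counts for \<open>1 \<le> l, j \<le> k - 1\<close>.\<close>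

definition phi :: "('n \<Rightarrow> nat) \<Rightarrow> nat \<Rightarrow> (nat \<Rightarrow> nat \<Rightarrow> real) \<Rightarrow> complex^'n \<Rightarrow> 'n \<Rightarrow> 'n \<Rightarrow> real" where
  "phi label k c z l j =
     (if l = j then 1 / (cmod (z$l))\<^sup>2 else 0) +
     (if label l \<in> {1..k-1} \<and> label j \<in> {1..k-1} then c (label l) (label j) else 0)"

text \<open>The formula on the open dense torus orbit determines \<open>J\<close> by continuity.\<close>

definition toric_gk ::
  "('n \<Rightarrow> nat) \<Rightarrow> nat \<Rightarrow> (nat \<Rightarrow> nat \<Rightarrow> real) \<Rightarrow> (complex^'n \<Rightarrow> (complex^'n) \<Rightarrow>\<^sub>L (complex^'n)) \<Rightarrow> bool" where
  "toric_gk label k c J \<longleftrightarrow>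
     gk_symplectic Cspace (\<lambda>_. Omega0) J \<and>
     (\<forall>z. (\<forall>i. z$i \<noteq> 0) \<longrightarrow>
        (\<forall>l. J z (d_nu z l) = (\<Sum>j\<in>UNIV. phi label k c z l j *\<^sub>R d_theta z j)))"

section \<open>Reduction by the diagonal circle\<close>

definition Xgen :: "complex^'n \<Rightarrow> complex^'n" where
  "Xgen z = \<i> *s z"

definition CP :: "(complex^'n) qman" where
  "CP = \<lparr>pts = sphere 0 1, tang = (\<lambda>z. {v. z \<bullet> v = 0}), vert = (\<lambda>z. span {Xgen z}),
         grp = {\<lambda>w. u *s w | u. cmod u = 1}\<rparr>"

text \<open>The Fubini--Study form is the form on \<open>\<complex>P\<^sup>n\<close> whose pullback to the sphere is the restriction
  of \<open>\<Omega>\<^sub>0\<close>, so in the representation of \<open>T\<complex>P\<^sup>n\<close> used here it is given by \<open>\<Omega>\<^sub>0\<close>.\<close>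

definition fubini_study :: "complex^'n \<Rightarrow> complex^'n \<Rightarrow> (complex^'n) \<Rightarrow>\<^sub>L real" where
  "fubini_study z = Omega0"

text \<open>\<open>span {X - b(X), df}\<close>, where \<open>df = z \<bullet> _\<close> for \<open>f = |z|\<^sup>2 / 2\<close>.\<close>

definition Khat :: "(complex^'n \<Rightarrow> (complex^'n) \<Rightarrow>\<^sub>L (complex^'n)) \<Rightarrow> complex^'n \<Rightarrow> (complex^'n) gvec set" where
  "Khat J z =
     span {(Xgen z, - bfield UNIV Omega0 (J z) (Xgen z)), (0, blinfun_inner_right z)}"

definition perp :: "'v::euclidean_space gvec set \<Rightarrow> 'v gvec set" where
  "perp K = {e. \<forall>\<kappa>\<in>K. pairing e \<kappa> = 0}"

text \<open>\<open>L \<inter> K\<^sup>\<perp> + K\<close> (complexified)\<close>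

definition reduced_bundle ::
  "'v::euclidean_space gvec set \<Rightarrow> ('v gvec \<times> 'v gvec) set \<Rightarrow> ('v gvec \<times> 'v gvec) set" where
  "reduced_bundle K L =
     {l + \<kappa> | l \<kappa>. l \<in> L \<inter> (perp K \<times> perp K) \<and> \<kappa> \<in> K \<times> K}"

text \<open>
  \<open>splitting J z \<Phi>\<close>: on \<open>perp (Khat J z)\<close>, \<open>\<Phi>\<close> represents an isomorphism of the fibre of the reduced
  Courant algebroid \<open>(Khat\<^sup>\<perp>/Khat)/S\<^sup>1\<close> with that of \<open>T\<complex>P\<^sup>n \<oplus> T\<^sup>*\<complex>P\<^sup>n\<close>, compatible with the
  projections to \<open>T\<complex>P\<^sup>n\<close> and the natural pairings.  Since the kernel of the pairing on
  \<open>perp (Khat J z)\<close> is \<open>Khat J z\<close>, preservation of the pairing makes the induced map injective,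
  hence bijective by dimension.
\<close>

definition splitting ::
  "(complex^'n \<Rightarrow> (complex^'n) \<Rightarrow>\<^sub>L (complex^'n)) \<Rightarrow> complex^'n \<Rightarrow> ((complex^'n) gvec \<Rightarrow> (complex^'n) gvec) \<Rightarrow> bool" where
  "splitting J z \<Phi> \<longleftrightarrow>
     linear \<Phi> \<and>
     (\<forall>e\<in>perp (Khat J z). \<Phi> e \<in> gtan (tang CP z) (vert CP z) \<and> fst (\<Phi> e) - fst e \<in> vert CP z) \<and>
     (\<forall>e\<in>perp (Khat J z). \<forall>e'\<in>perp (Khat J z). pairing (\<Phi> e) (\<Phi> e') = pairing e e')"

text \<open>
  \<open>I\<close> is the \<open>J\<^sub>+\<close> of the reduced generalized Kaehler structure on \<open>\<complex>P\<^sup>n\<close>: in a suitable (namely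
  the metric) splitting, the eigenbundles of the two generalized complex structures defined by
  \<open>I\<close> and the Fubini--Study form are the reduced eigenbundles.  This determines \<open>I\<close>, modulo \<open>vert\<close>.
\<close>

definition gk_reduction ::
  "(complex^'n \<Rightarrow> (complex^'n) \<Rightarrow>\<^sub>L (complex^'n)) \<Rightarrow> (complex^'n \<Rightarrow> (complex^'n) \<Rightarrow>\<^sub>L (complex^'n)) \<Rightarrow> bool" where
  "gk_reduction J I \<longleftrightarrow>
     gk_symplectic CP fubini_study I \<and>
     (\<forall>z\<in>pts CP. \<exists>\<Phi>. splitting J z \<Phi> \<and>
        (\<forall>l \<in> perp (Khat J z) \<times> perp (Khat J z).
           (l \<in> reduced_bundle (Khat J z) (eigenbundle UNIV {0} (GJ1 UNIV Omega0 (J z))) \<longleftrightarrow>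
            map_prod \<Phi> \<Phi> l \<in>
              eigenbundle (tang CP z) (vert CP z) (GJ1 (tang CP z) (fubini_study z) (I z))) \<and>
           (l \<in> reduced_bundle (Khat J z) (eigenbundle UNIV {0} (GJ2 UNIV Omega0 (J z))) \<longleftrightarrow>
            map_prod \<Phi> \<Phi> l \<in>
              eigenbundle (tang CP z) (vert CP z) (GJ2 (tang CP z) (fubini_study z) (I z)))))"

section \<open>The unitary group acting on the last coordinates\<close>

definition unitary_block :: "('n::finite \<Rightarrow> nat) \<Rightarrow> nat \<Rightarrow> (complex^'n^'n) set" where
  "unitary_block label k =
     {A. (\<chi> i j. cnj (A$j$i)) ** A = mat 1 \<and>
         (\<forall>i j. label i < k \<or> label j < k \<longrightarrow> A$i$j = (if i = j then 1 else 0))}"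

end

theory Submission
  imports Defs
begin

text \<open>
  A generalized Kaehler structure of symplectic type can be read off from the intersection of the
  \<open>\<i>\<close>-eigenbundles of its two generalized complex structures: that intersection contains the elements
  \<open>(v + g v) + \<i> (J\<^sub>+ v + g J\<^sub>+ v)\<close>, and conversely the tangent parts \<open>x\<close>, \<open>y\<close> of any of its elements
  satisfy \<open>y = J\<^sub>+ x\<close> (\<open>graph_in_eigenbundles\<close>, \<open>eigenbundles_imp_J\<close>).  On \<open>\<complex>\<^sup>n\<^sup>+\<^sup>1\<close> such an element is
  orthogonal to \<open>X - b X\<close> and \<open>df\<close> as soon as \<open>v\<close> is horizontal, that is \<open>df v = df (J\<^sub>+ v) = 0\<close>.  So the
  reduced complex structure \<open>I\<close> is \<open>J\<^sub>+\<close> on horizontal vectors, modulo \<open>X\<close>, and this does not depend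
  on the splitting (\<open>gk_reduction_on_horizontal\<close>).  Taming gives \<open>df (J\<^sub>+ X) < 0\<close>, so the horizontal
  vectors and \<open>X\<close> span the tangent space of the sphere (\<open>horizontal_decomposition\<close>), and \<open>I\<close> is known.

  Write \<open>B\<close> for the factor \<open>\<complex>\<^sup>n\<^sup>+\<^sup>1\<^sup>-\<^sup>k\<close> with the coordinates labelled \<open>k\<close> or higher.  The bivector \<open>C\<close> does
  not involve these coordinates, so \<open>J\<^sub>+\<close> is multiplication by \<open>\<i>\<close> on \<open>B\<close>, it preserves the complementary
  factor, and it depends on the complementary coordinates of the point alone (\<open>J_block\<close>, \<open>block_J\<close>,
  \<open>J_cong\<close>).  Block unitary matrices therefore commute with \<open>J\<^sub>+\<close>, respect horizontality, and preserve
  \<open>I\<close> (\<open>I_preserved\<close>).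

  For the vanishing of \<open>\<beta>\<^sub>1\<close>, use \<open>\<Omega>\<close> to regard \<open>\<beta>\<^sub>1\<close> as a skew form on tangent vectors.  A vector \<open>Y\<close> with
  \<open>I\<^sub>+ Y = I\<^sub>- Y\<close> lies in its radical.  This applies to every \<open>Y\<close> in \<open>B\<close> that is complex orthogonal to the
  point \<open>z\<close>, because \<open>I\<^sub>+\<close> and \<open>I\<^sub>-\<close> are both multiplication by \<open>\<i>\<close> there (\<open>I_eq_Iminus_on_block\<close>).  If \<open>w\<close> is
  the component of \<open>z\<close> in \<open>B\<close>, then a generating vector field, being skew-Hermitian with values in \<open>B\<close>,
  has at \<open>z\<close> the value \<open>Y + r \<i> w\<close> with such a \<open>Y\<close> and a real \<open>r\<close>.  Modulo the radical all generators are
  thus multiples of the single real vector \<open>\<i> w\<close>, and a skew form vanishes on a line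
  (\<open>poisson1_eq_0\<close>, \<open>poisson1_I_eq_0\<close>).
\<close>

section \<open>Linear algebra of a tamed skew form on a quotient space\<close>

text \<open>
  A finite-dimensional Lax-Milgram lemma modulo the degenerate directions \<open>R\<close>: positivity makes \<open>B\<close>
  injective on the orthogonal complement of \<open>R\<close> in \<open>S\<close>, hence bijective onto its dual.  The solution is
  produced by one linear operator so that it can also be used to construct endomorphisms.
\<close>

lemma tamed_form_solution_operator:
  fixes B :: "'v::euclidean_space \<Rightarrow> 'v \<Rightarrow>\<^sub>L real"
  assumes S: "subspace S" and R: "subspace R" and RS: "R \<subseteq> S" and linB: "linear B"
    and Bvert: "\<And>x r. x \<in> S \<Longrightarrow> r \<in> R \<Longrightarrow> B x r = 0"
    and pos: "\<And>x. x \<in> S \<Longrightarrow> x \<notin> R \<Longrightarrow> B x x > 0"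
  obtains G :: "('v \<Rightarrow>\<^sub>L real) \<Rightarrow> 'v" where "linear G" "\<And>\<alpha>. G \<alpha> \<in> S"
    "\<And>\<alpha> y. (\<And>r. r \<in> R \<Longrightarrow> blinfun_apply \<alpha> r = 0) \<Longrightarrow> y \<in> S \<Longrightarrow> B (G \<alpha>) y = \<alpha> y"
proof -
  define D where "D = {x\<in>S. \<forall>r\<in>R. orthogonal r x}"
  have D: "subspace D"
    using S unfolding D_def subspace_def by (auto simp: orthogonal_def inner_right_distrib)
  have DR: "x = 0" if "x \<in> D" "x \<in> R" for x
    using that by (auto simp: D_def orthogonal_def)
  obtain E where E: "E \<subseteq> D" "pairwise orthogonal E" "\<And>x. x \<in> E \<Longrightarrow> norm x = 1"
    "independent E" "card E = dim D" "span E = D"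
    using orthonormal_basis_subspace[OF D] by metis
  have finE: "finite E" using E(4) by (rule independent_imp_finite)
  have expand: "y = (\<Sum>b\<in>E. (y \<bullet> b) *\<^sub>R b)" if "y \<in> D" for y
  proof -
    have "y \<in> span E" using that E by simp
    then show ?thesis
      using orthonormal_basis_expand[of E y] E(2,3) finE by simp
  qed
  define rep where "rep \<alpha> = (\<Sum>b\<in>E. blinfun_apply \<alpha> b *\<^sub>R b)" for \<alpha> :: "'v \<Rightarrow>\<^sub>L real"
  have linrep: "linear rep"
    by (rule linearI) (simp_all add: rep_def blinfun.add_left blinfun.scaleR_left
        scaleR_add_left sum.distrib scaleR_sum_right)
  have repD: "rep \<alpha> \<in> D" for \<alpha>
    unfolding rep_def using E(1) D by (intro subspace_sum subspace_scale) auto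
  have rep_inner: "y \<bullet> rep \<alpha> = \<alpha> y" if "y \<in> D" for y \<alpha>
  proof -
    have "\<alpha> y = \<alpha> (\<Sum>b\<in>E. (y \<bullet> b) *\<^sub>R b)" using expand[OF that] by simp
    also have "\<dots> = y \<bullet> rep \<alpha>"
      by (simp add: rep_def blinfun.sum_right blinfun.scaleR_right inner_sum_right mult.commute)
    finally show ?thesis by simp
  qed
  define T where "T = rep \<circ> B"
  have linT: "linear T" unfolding T_def by (intro linear_compose linB linrep)
  \<comment> \<open>\<open>T\<close> represents \<open>B\<close> restricted to \<open>D\<close> by the inner product: \<open>y \<bullet> T x = B x y\<close> for \<open>y\<close> in \<open>D\<close>.\<close>
  have inj: "inj_on T D"
  proof (subst linear_inj_on_iff_eq_0[OF linT D], intro ballI impI)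
    fix x assume x: "x \<in> D" "T x = 0"
    then have "B x x = 0" using rep_inner[OF x(1), of "B x"] by (simp add: T_def)
    then show "x = 0" using x DR pos[of x] by (force simp: D_def)
  qed
  have TD: "T ` D = D"
  proof (rule subspace_dim_equal)
    show "subspace (T ` D)" by (rule linear_subspace_image[OF linT D])
    show "T ` D \<subseteq> D" using repD by (auto simp: T_def)
    show "dim D \<le> dim (T ` D)" using dim_image_eq[OF linT, of D] inj D
      by (simp add: span_eq_iff[THEN iffD2])
  qed (rule D)
  obtain H where H: "range H \<subseteq> D" "linear H" "\<And>v. v \<in> D \<Longrightarrow> H (T v) = v"
    using linear_exists_left_inverse_on[OF linT D inj] by blast
  have TH: "T (H a) = a" if "a \<in> D" for a
    using that TD H(3) by (metis imageE)
  show ?thesis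
  proof
    show "linear (H \<circ> rep)" by (intro linear_compose linrep H)
    show HS: "(H \<circ> rep) \<alpha> \<in> S" for \<alpha> using H(1) by (auto simp: D_def)
    fix \<alpha> :: "'v \<Rightarrow>\<^sub>L real" and y
    assume \<alpha>: "\<And>r. r \<in> R \<Longrightarrow> \<alpha> r = 0" and y: "y \<in> S"
    obtain r d where rd: "r \<in> span R" "\<And>w. w \<in> span R \<Longrightarrow> orthogonal d w" "y = r + d"
      using orthogonal_subspace_decomp_exists[of R y] by metis
    then have rR: "r \<in> R" using R by (simp add: span_eq_iff[THEN iffD2])
    then have "d \<in> S" using rd(3) y RS S by (metis add_diff_cancel_left' subsetD subspace_diff)
    then have d: "d \<in> D" using rd(2) span_base by (auto simp: D_def orthogonal_commute)
    have "B ((H \<circ> rep) \<alpha>) d = d \<bullet> T (H (rep \<alpha>))" using rep_inner[OF d] by (simp add: T_def)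
    also have "\<dots> = \<alpha> d" using TH[OF repD] rep_inner[OF d] by simp
    finally show "B ((H \<circ> rep) \<alpha>) y = \<alpha> y"
      using rd(3) \<alpha>[OF rR] Bvert[OF HS rR] by (simp add: blinfun.add_right)
  qed
qed

text \<open>
  The tangent space of the quotient at a point is \<open>S / R\<close>.  Taming forces \<open>R\<close> to be the whole kernel
  of \<open>\<Omega>\<close> on \<open>S\<close>, so that equality in \<open>S / R\<close> can be tested with \<open>\<Omega>\<close>.
\<close>

locale tamed_quotient =
  fixes S R :: "'v::euclidean_space set" and \<Omega> :: "'v \<Rightarrow> 'v \<Rightarrow>\<^sub>L real" and J :: "'v \<Rightarrow>\<^sub>L 'v"
  assumes S: "subspace S" and R: "subspace R" and R_subset_S: "R \<subseteq> S"
    and \<Omega>_linear: "linear \<Omega>"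
    and \<Omega>_skew: "\<And>x y. \<Omega> x y = - \<Omega> y x"
    and \<Omega>_R: "\<And>x r. x \<in> S \<Longrightarrow> r \<in> R \<Longrightarrow> \<Omega> x r = 0"
    and J_S: "\<And>x. x \<in> S \<Longrightarrow> J x \<in> S"
    and J_R: "\<And>x. x \<in> R \<Longrightarrow> J x \<in> R"
    and J_J: "\<And>x. x \<in> S \<Longrightarrow> J (J x) + x \<in> R"
    and tamed: "\<And>x. x \<in> S \<Longrightarrow> x \<notin> R \<Longrightarrow> \<Omega> x (J x) > 0"
begin

abbreviation Jm :: "'v \<Rightarrow>\<^sub>L 'v" where "Jm \<equiv> Jminus S \<Omega> J"
abbreviation g :: "'v \<Rightarrow> 'v \<Rightarrow>\<^sub>L real" where "g \<equiv> gmet S \<Omega> J"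

lemmas S_closed = subspace_add[OF S] subspace_diff[OF S] subspace_scale[OF S] subspace_neg[OF S]
lemmas R_closed = subspace_add[OF R] subspace_diff[OF R] subspace_scale[OF R] subspace_neg[OF R]

lemma R_S: "r \<in> R \<Longrightarrow> r \<in> S"
  using R_subset_S by auto

lemma \<Omega>_left:
  "\<Omega> (x + y) = \<Omega> x + \<Omega> y" "\<Omega> (x - y) = \<Omega> x - \<Omega> y" "\<Omega> (- x) = - \<Omega> x" "\<Omega> (a *\<^sub>R x) = a *\<^sub>R \<Omega> x"
  using \<Omega>_linear by (auto simp: linear_add linear_diff linear_neg linear_cmul)

lemmas lin = \<Omega>_left blinfun.add_left blinfun.add_right blinfun.diff_left blinfun.diff_right
  blinfun.minus_left blinfun.minus_right blinfun.scaleR_left blinfun.scaleR_right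

lemma \<Omega>_cong_R:
  assumes "a - b \<in> R" "y \<in> S"
  shows "\<Omega> a y = \<Omega> b y" "\<Omega> y a = \<Omega> y b"
proof -
  show "\<Omega> y a = \<Omega> y b" using \<Omega>_R[OF assms(2,1)] by (simp add: lin)
  then show "\<Omega> a y = \<Omega> b y" using \<Omega>_skew by metis
qed

lemma R_iff: "x \<in> S \<Longrightarrow> x \<in> R \<longleftrightarrow> (\<forall>y\<in>S. \<Omega> x y = 0)"
  using \<Omega>_R[of _ x] \<Omega>_skew[of x] tamed[of x] J_S[of x] by (metis neg_equal_0_iff_equal less_irrefl)

lemma diff_in_R_iff:
  assumes "x \<in> S" "y \<in> S"
  shows "x - y \<in> R \<longleftrightarrow> (\<forall>w\<in>S. \<Omega> x w = \<Omega> y w)"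
  using R_iff[of "x - y"] assms by (simp add: S_closed lin)

lemma \<Omega>_J_J: "x \<in> S \<Longrightarrow> y \<in> S \<Longrightarrow> \<Omega> x (J (J y)) = - \<Omega> x y"
  using \<Omega>_R[OF _ J_J] by (force simp: lin)

text \<open>
  The form \<open>\<Omega>(x, J y)\<close> is positive by taming.  Solving \<open>\<Omega>(J' x, J y) = \<Omega>(x, y)\<close> for \<open>J' x\<close> and then
  replacing \<open>y\<close> by \<open>J y\<close> gives the defining equation of \<open>J\<^sub>-\<close>.
\<close>

lemma Jm_exists:
  obtains J' :: "'v \<Rightarrow>\<^sub>L 'v" where "J' ` S \<subseteq> S" "\<And>x y. x \<in> S \<Longrightarrow> y \<in> S \<Longrightarrow> \<Omega> (J' x) y = - \<Omega> x (J y)"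
proof -
  define B where "B x = \<Omega> x o\<^sub>L J" for x
  obtain G where G: "linear G" "\<And>\<alpha>. G \<alpha> \<in> S"
    "\<And>\<alpha> y. (\<And>r. r \<in> R \<Longrightarrow> blinfun_apply \<alpha> r = 0) \<Longrightarrow> y \<in> S \<Longrightarrow> B (G \<alpha>) y = \<alpha> y"
  proof (rule tamed_form_solution_operator[OF S R R_subset_S, of B])
    show "linear B"
      by (rule linearI) (auto simp: B_def lin intro!: blinfun_eqI)
  qed (auto simp: B_def tamed \<Omega>_R J_R)
  define J' where "J' = Blinfun (\<lambda>x. G (\<Omega> x))"
  have "bounded_linear (\<lambda>x. G (\<Omega> x))"
    using linear_compose[OF \<Omega>_linear G(1)] by (simp add: linear_conv_bounded_linear o_def)
  then have J': "J' x = G (\<Omega> x)" for x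
    by (simp add: J'_def bounded_linear_Blinfun_apply)
  show ?thesis
  proof
    show "J' ` S \<subseteq> S" using G(2) by (auto simp: J')
    fix x y assume xy: "x \<in> S" "y \<in> S"
    have "\<Omega> (J' x) (J (J y)) = \<Omega> x (J y)"
      using G(3)[of "\<Omega> x" "J y"] xy by (simp add: B_def J' \<Omega>_R J_S)
    then show "\<Omega> (J' x) y = - \<Omega> x (J y)"
      using \<Omega>_J_J[of "J' x" y] xy G(2) by (simp add: J')
  qed
qed

lemma Jm_S: "x \<in> S \<Longrightarrow> Jm x \<in> S"
  and \<Omega>_Jm: "x \<in> S \<Longrightarrow> y \<in> S \<Longrightarrow> \<Omega> (Jm x) y = - \<Omega> x (J y)"
proof -
  have "Jm ` S \<subseteq> S \<and> (\<forall>x\<in>S. \<forall>y\<in>S. \<Omega> (Jm x) y = - (\<Omega> x o\<^sub>L J) y)"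
    unfolding Jminus_def by (rule someI_ex, rule Jm_exists) auto
  then show "x \<in> S \<Longrightarrow> Jm x \<in> S"
    "x \<in> S \<Longrightarrow> y \<in> S \<Longrightarrow> \<Omega> (Jm x) y = - \<Omega> x (J y)" by auto
qed

lemma \<Omega>_J: "x \<in> S \<Longrightarrow> y \<in> S \<Longrightarrow> \<Omega> (J x) y = - \<Omega> x (Jm y)"
  using \<Omega>_Jm[of y x] \<Omega>_skew[of "J x" y] \<Omega>_skew[of x "Jm y"] by simp

lemma Jm_R: "r \<in> R \<Longrightarrow> Jm r \<in> R"
  using R_S[of r] \<Omega>_skew[of r] by (subst R_iff) (auto simp: Jm_S \<Omega>_Jm J_S \<Omega>_R)

lemma Jm_Jm: "x \<in> S \<Longrightarrow> Jm (Jm x) + x \<in> R"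
  by (subst R_iff) (auto simp: S_closed Jm_S J_S lin \<Omega>_Jm \<Omega>_J_J)

lemma \<Omega>_Jm_Jm: "x \<in> S \<Longrightarrow> y \<in> S \<Longrightarrow> \<Omega> x (Jm (Jm y)) = - \<Omega> x y"
  using \<Omega>_R[OF _ Jm_Jm] by (force simp: lin)

lemma g_apply: "g x y = - (\<Omega> (J x) y + \<Omega> (Jm x) y) / 2"
  by (simp add: gmet_def lin field_simps)

lemma g_linear: "linear g"
  by (rule linearI) (auto simp: g_apply lin field_simps intro!: blinfun_eqI)

lemma g_R: "x \<in> S \<Longrightarrow> r \<in> R \<Longrightarrow> g x r = 0" "x \<in> S \<Longrightarrow> r \<in> R \<Longrightarrow> g r x = 0"
  using \<Omega>_skew[of "J r" x] \<Omega>_skew[of "Jm r" x] by (auto simp: g_apply \<Omega>_R J_S Jm_S J_R Jm_R)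

lemma g_sym: "x \<in> S \<Longrightarrow> y \<in> S \<Longrightarrow> g x y = g y x"
  using \<Omega>_skew[of "J x" y] \<Omega>_skew[of "J y" x] by (simp add: g_apply \<Omega>_Jm)

lemma g_pos: "x \<in> S \<Longrightarrow> x \<notin> R \<Longrightarrow> g x x > 0"
  using tamed[of x] \<Omega>_skew[of "J x" x] by (simp add: g_apply \<Omega>_Jm)

lemma g_J: "x \<in> S \<Longrightarrow> y \<in> S \<Longrightarrow> g (J x) y = - g x (J y)"
  using \<Omega>_J_J[of y x] \<Omega>_J_J[of x y] \<Omega>_skew[of "J (J x)" y] \<Omega>_skew[of x y]
  by (simp add: g_apply \<Omega>_Jm J_S field_simps)

lemma g_Jm: "x \<in> S \<Longrightarrow> y \<in> S \<Longrightarrow> g (Jm x) y = - g x (Jm y)"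
  using \<Omega>_Jm_Jm[of y x] \<Omega>_Jm_Jm[of x y] \<Omega>_skew[of "Jm (Jm x)" y] \<Omega>_skew[of x y]
  by (simp add: g_apply \<Omega>_J Jm_S field_simps)

lemma g_eqD: "x \<in> S \<Longrightarrow> y \<in> S \<Longrightarrow> \<forall>w\<in>S. g x w = g y w \<Longrightarrow> x - y \<in> R"
  using g_pos[of "x - y"] by (force simp: S_closed linear_diff[OF g_linear] lin)

lemma sharp_g:
  fixes \<alpha> :: "'v \<Rightarrow>\<^sub>L real"
  assumes "\<And>r. r \<in> R \<Longrightarrow> \<alpha> r = 0"
  shows "sharp S g \<alpha> \<in> S" "\<And>y. y \<in> S \<Longrightarrow> g (sharp S g \<alpha>) y = \<alpha> y"
proof -
  obtain G where G: "linear G" "\<And>\<alpha>. G \<alpha> \<in> S"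
    "\<And>\<alpha> y. (\<And>r. r \<in> R \<Longrightarrow> blinfun_apply \<alpha> r = 0) \<Longrightarrow> y \<in> S \<Longrightarrow> g (G \<alpha>) y = \<alpha> y"
  proof (rule tamed_form_solution_operator[OF S R R_subset_S g_linear])
  qed (auto intro: g_R(1) g_pos)
  have "sharp S g \<alpha> \<in> S \<and> (\<forall>y\<in>S. g (sharp S g \<alpha>) y = \<alpha> y)"
    unfolding sharp_def
    by (rule someI[of "\<lambda>x. x \<in> S \<and> (\<forall>y\<in>S. g x y = \<alpha> y)" "G \<alpha>"]) (simp add: G(2,3) assms)
  then show "sharp S g \<alpha> \<in> S" "\<And>y. y \<in> S \<Longrightarrow> g (sharp S g \<alpha>) y = \<alpha> y" by auto
qed

text \<open>
  For \<open>K = J\<^sub>\<plusminus>\<close> this is \<open>\<omega>\<^sub>\<plusminus>\<^sup>-\<^sup>1 g = J\<^sub>\<plusminus>\<^sup>-\<^sup>1 = - J\<^sub>\<plusminus>\<close>, up to the choice that \<open>sharp\<close> makes modulo \<open>R\<close>.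
\<close>

lemma sharp_g_comp:
  fixes \<alpha> :: "'v \<Rightarrow>\<^sub>L real" and K :: "'v \<Rightarrow>\<^sub>L 'v"
  assumes K: "\<And>x. x \<in> S \<Longrightarrow> K x \<in> S" "\<And>x. x \<in> R \<Longrightarrow> K x \<in> R" "\<And>x. x \<in> S \<Longrightarrow> K (K x) + x \<in> R"
    and x: "x \<in> S" and \<alpha>: "\<And>y. y \<in> S \<Longrightarrow> \<alpha> y = g x y"
  shows "sharp S (\<lambda>x. g (blinfun_apply K x)) \<alpha> + K x \<in> R"
proof -
  define s where "s = sharp S (\<lambda>x. g (K x)) \<alpha>"
  have "g (K (- K x)) y = \<alpha> y" if "y \<in> S" for y
    using g_R(2)[OF that K(3)[OF x]] \<alpha>[OF that]
    by (simp add: linear_neg[OF g_linear] linear_add[OF g_linear] lin)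
  then have "s \<in> S \<and> (\<forall>y\<in>S. g (K s) y = \<alpha> y)"
    unfolding s_def sharp_def
    by (intro someI[of "\<lambda>s. s \<in> S \<and> (\<forall>y\<in>S. g (K s) y = \<alpha> y)" "- K x"]) (simp add: S_closed(4) K(1) x)
  then have s: "s \<in> S" "\<forall>y\<in>S. g (K s) y = g x y" using \<alpha> by auto
  then have "K s - x \<in> R" by (intro g_eqD K(1) x)
  then have "K (K s - x) \<in> R" by (rule K(2))
  then have "(K (K s) + s) - K (K s - x) \<in> R" by (intro R_closed(2) K(3) s(1))
  then show "sharp S (\<lambda>x. g (K x)) \<alpha> + K x \<in> R"
    by (simp add: s_def[symmetric] lin add.commute)
qed

lemma sharp_omega:
  assumes "x \<in> S" "\<And>y. y \<in> S \<Longrightarrow> blinfun_apply \<alpha> y = g x y"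
  shows "sharp S (omega_plus S \<Omega> J) \<alpha> + J x \<in> R" "sharp S (omega_minus S \<Omega> J) \<alpha> + Jm x \<in> R"
proof -
  have "omega_plus S \<Omega> J = (\<lambda>x. g (J x))" "omega_minus S \<Omega> J = (\<lambda>x. g (Jm x))"
    by (auto simp: omega_plus_def omega_minus_def)
  then show "sharp S (omega_plus S \<Omega> J) \<alpha> + J x \<in> R" "sharp S (omega_minus S \<Omega> J) \<alpha> + Jm x \<in> R"
    by (simp_all only: sharp_g_comp[OF J_S J_R J_J assms] sharp_g_comp[OF Jm_S Jm_R Jm_Jm assms])
qed

text \<open>
  Both generalized complex structures act as \<open>- J\<^sub>+\<close> on the graph of \<open>g\<close>, because \<open>\<omega>\<^sub>\<plusminus>\<^sup>-\<^sup>1 g = - J\<^sub>\<plusminus>\<close> and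
  \<open>J\<^sub>\<plusminus>\<close> are skew with respect to \<open>g\<close>.
\<close>

lemma GJ_graph:
  assumes v: "v \<in> S"
  shows "gt_eq S R (GJ1 S \<Omega> J (v, g v)) (- (J v, g (J v)))"
    and "gt_eq S R (GJ2 S \<Omega> J (v, g v)) (- (J v, g (J v)))"
proof -
  define p where "p = sharp S (omega_plus S \<Omega> J) (g v)"
  define q where "q = sharp S (omega_minus S \<Omega> J) (g v)"
  have pq: "p + J v \<in> R" "q + Jm v \<in> R" unfolding p_def q_def by (intro sharp_omega v refl)+
  have 1: "(1/2) *\<^sub>R (- J v - Jm v + p - q) + J v = (1/2) *\<^sub>R ((p + J v) - (q + Jm v))"
    by (rule vector_eq_rdot[THEN iffD1]) (simp add: inner_add_right inner_diff_right algebra_simps)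
  have 2: "(1/2) *\<^sub>R (- J v + Jm v + p + q) + J v = (1/2) *\<^sub>R ((p + J v) + (q + Jm v))"
    by (rule vector_eq_rdot[THEN iffD1]) (simp add: inner_add_right inner_diff_right algebra_simps)
  show "gt_eq S R (GJ1 S \<Omega> J (v, g v)) (- (J v, g (J v)))"
    using pq v 1 unfolding p_def q_def
    by (auto simp: gt_eq_def GJ1_def Let_def omega_plus_def omega_minus_def lin R_closed g_J g_Jm)
  show "gt_eq S R (GJ2 S \<Omega> J (v, g v)) (- (J v, g (J v)))"
    using pq v 2 unfolding p_def q_def
    by (auto simp: gt_eq_def GJ2_def Let_def omega_plus_def omega_minus_def lin R_closed g_J g_Jm)
qed

lemma graph_in_eigenbundles:
  assumes v: "v \<in> S"
  shows "((v, g v), (J v, g (J v))) \<in> eigenbundle S R (GJ1 S \<Omega> J)"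
    and "((v, g v), (J v, g (J v))) \<in> eigenbundle S R (GJ2 S \<Omega> J)"
proof -
  have "J (J v) + v \<in> R" using v by (rule J_J)
  moreover have "g (J (J v)) y = - g v y" if "y \<in> S" for y
    using g_R(2)[OF that J_J[OF v]] by (simp add: linear_add[OF g_linear] lin)
  ultimately have *: "gt_eq S R e (v, g v)" if "gt_eq S R e (- (J (J v), g (J (J v))))" for e
    using that R_closed(2)[of "fst e + J (J v)" "J (J v) + v"]
    by (auto simp: gt_eq_def lin)
  show "((v, g v), (J v, g (J v))) \<in> eigenbundle S R (GJ1 S \<Omega> J)"
       "((v, g v), (J v, g (J v))) \<in> eigenbundle S R (GJ2 S \<Omega> J)"
    using GJ_graph[OF v] *[OF GJ_graph(1)[OF J_S[OF v]]] *[OF GJ_graph(2)[OF J_S[OF v]]]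
    by (auto simp: eigenbundle_def gtan_def v J_S g_R)
qed

text \<open>
  Write the covector part of \<open>a\<close> as \<open>g u\<close>.  The tangent parts of the two eigenvector equations have the
  difference \<open>J\<^sub>- (x - u) = 0\<close>, so that \<open>u = x\<close>, and then the sum \<open>y = J\<^sub>+ x\<close>.
\<close>

lemma eigenbundles_imp_J:
  assumes 1: "(a, b) \<in> eigenbundle S R (GJ1 S \<Omega> J)" and 2: "(a, b) \<in> eigenbundle S R (GJ2 S \<Omega> J)"
  shows "fst b - J (fst a) \<in> R"
proof -
  define x y \<xi> where "x = fst a" and "y = fst b" and "\<xi> = snd a"
  define p where "p = sharp S (omega_plus S \<Omega> J) \<xi>"
  define q where "q = sharp S (omega_minus S \<Omega> J) \<xi>"
  have x: "x \<in> S" and y: "y \<in> S" and \<xi>: "\<And>r. r \<in> R \<Longrightarrow> \<xi> r = 0"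
    using 1 by (auto simp: eigenbundle_def gtan_def case_prod_unfold x_def y_def \<xi>_def)
  define u where "u = sharp S g \<xi>"
  have u: "u \<in> S" "\<And>y. y \<in> S \<Longrightarrow> \<xi> y = g u y"
    unfolding u_def using sharp_g[of \<xi>] \<xi> by auto
  have pq: "p + J u \<in> R" "q + Jm u \<in> R" unfolding p_def q_def by (intro sharp_omega u; assumption)+
  have e1: "(1/2) *\<^sub>R (- J x - Jm x + p - q) + y \<in> R"
    and e2: "(1/2) *\<^sub>R (- J x + Jm x + p + q) + y \<in> R"
    using 1 2 by (auto simp: eigenbundle_def gt_eq_def GJ1_def GJ2_def Let_def p_def q_def x_def y_def \<xi>_def)
  have "((1/2) *\<^sub>R (- J x + Jm x + p + q) + y) - ((1/2) *\<^sub>R (- J x - Jm x + p - q) + y) - (q + Jm u) = Jm (x - u)"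
    by (rule vector_eq_rdot[THEN iffD1])
       (simp add: inner_add_right inner_diff_right lin algebra_simps)
  then have "Jm (x - u) \<in> R" using R_closed(2) e1 e2 pq by metis
  then have "Jm (Jm (x - u)) \<in> R" by (rule Jm_R)
  then have "(Jm (Jm (x - u)) + (x - u)) - Jm (Jm (x - u)) \<in> R"
    by (intro R_closed Jm_Jm S_closed x u)
  then have xu: "J (x - u) \<in> R" by (simp add: J_R)
  have "(1/2) *\<^sub>R (((1/2) *\<^sub>R (- J x + Jm x + p + q) + y) + ((1/2) *\<^sub>R (- J x - Jm x + p - q) + y)
      - (p + J u) - J (x - u)) = y - J x"
    by (rule vector_eq_rdot[THEN iffD1])
       (simp add: inner_add_right inner_diff_right lin algebra_simps)
  then have "y - J x \<in> R" using R_closed e1 e2 pq xu by metis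
  then show ?thesis by (simp add: x_def y_def)
qed

text \<open>
  With \<open>\<alpha> = - \<Omega> u\<close>, the equation \<open>g x = \<alpha>\<close> that enters \<open>\<beta>\<^sub>1\<close> becomes \<open>(J\<^sub>+ + J\<^sub>-) x = 2 u\<close>.
\<close>

lemma poisson1_eq:
  assumes u: "u \<in> S" and v: "v \<in> S" and x: "x \<in> S" and xu: "J x + Jm x - 2 *\<^sub>R u \<in> R"
    and \<alpha>: "\<And>y. y \<in> S \<Longrightarrow> blinfun_apply \<alpha> y = - \<Omega> u y"
    and \<gamma>: "\<And>y. y \<in> S \<Longrightarrow> blinfun_apply \<gamma> y = - \<Omega> v y"
  shows "poisson1 S \<Omega> J \<alpha> \<gamma> = \<Omega> v (J x - Jm x) / 2"
proof -
  define s where "s = sharp S g \<alpha>"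
  have \<alpha>R: "\<alpha> r = 0" if "r \<in> R" for r using that \<alpha>[OF R_S] u by (simp add: \<Omega>_R)
  have s: "s \<in> S" "\<And>y. y \<in> S \<Longrightarrow> g s y = \<alpha> y" unfolding s_def using sharp_g \<alpha>R by auto
  have "g x w = \<alpha> w" if "w \<in> S" for w
    using \<Omega>_cong_R(1)[OF xu that] \<alpha>[OF that] by (simp add: g_apply lin)
  then have "s - x \<in> R" using g_eqD s x by auto
  then have "J (s - x) \<in> R" "Jm (s - x) \<in> R" using J_R Jm_R by auto
  then have "\<Omega> v (J s) = \<Omega> v (J x)" "\<Omega> v (Jm s) = \<Omega> v (Jm x)"
    using \<Omega>_R[OF v] by (force simp: lin)+
  moreover have "- (1/2) *\<^sub>R (J s - Jm s) \<in> S" by (intro S_closed J_S Jm_S s)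
  note \<gamma>[OF this]
  ultimately show ?thesis
    unfolding poisson1_def beta1_def Let_def s_def[symmetric] by (simp add: lin)
qed

lemma half_sum_exists:
  assumes u: "u \<in> S"
  obtains x where "x \<in> S" "J x + Jm x - 2 *\<^sub>R u \<in> R"
proof -
  define s where "s = sharp S g (- \<Omega> u)"
  have s: "s \<in> S" "\<And>y. y \<in> S \<Longrightarrow> g s y = - \<Omega> u y" unfolding s_def using sharp_g[of "- \<Omega> u"] u \<Omega>_R
    by (auto simp: lin)
  have "J s + Jm s - 2 *\<^sub>R u \<in> R"
  proof (subst diff_in_R_iff, safe)
    fix w assume "w \<in> S"
    from s(2)[OF this] show "\<Omega> (J s + Jm s) w = \<Omega> (2 *\<^sub>R u) w"
      by (simp add: g_apply lin)
  qed (intro S_closed J_S Jm_S s u)+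
  with s(1) show ?thesis by (rule that)
qed

text \<open>
  \<open>\<beta>\<^sub>1\<close> corresponds under \<open>\<Omega>\<close> to a skew form on tangent vectors, and its radical contains the vectors on
  which \<open>J\<^sub>+\<close> and \<open>J\<^sub>-\<close> agree.  So \<open>Y\<close> and \<open>Y'\<close> do not contribute, and what remains is a skew form
  evaluated twice on \<open>e\<close>.
\<close>

lemma poisson1_eq_0:
  assumes e: "e \<in> S" and Y: "Y \<in> S" "J Y - Jm Y \<in> R" and Y': "Y' \<in> S" "J Y' - Jm Y' \<in> R"
    and \<alpha>: "\<And>y. y \<in> S \<Longrightarrow> blinfun_apply \<alpha> y = - \<Omega> (Y + r *\<^sub>R e) y"
    and \<gamma>: "\<And>y. y \<in> S \<Longrightarrow> blinfun_apply \<gamma> y = - \<Omega> (Y' + s *\<^sub>R e) y"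
  shows "poisson1 S \<Omega> J \<alpha> \<gamma> = 0"
proof -
  obtain t where t: "t \<in> S" "J t + Jm t - 2 *\<^sub>R e \<in> R" using half_sum_exists[OF e] .
  have JY: "J Y \<in> S" "Jm Y \<in> S" using Y by (auto simp: J_S Jm_S)
  \<comment> \<open>The solution of \<open>(J\<^sub>+ + J\<^sub>-) x = 2 (Y + r e)\<close>: on \<open>Y\<close> both structures agree and have square \<open>- 1\<close>.\<close>
  define x where "x = - J Y + r *\<^sub>R t"
  have x: "x \<in> S" unfolding x_def by (intro S_closed JY t)
  have c: "J (J Y) + Y \<in> R" "Jm (Jm Y) + Y \<in> R" "Jm (J Y - Jm Y) \<in> R"
    using J_J Jm_Jm Jm_R Y by auto
  have "J x + Jm x - 2 *\<^sub>R (Y + r *\<^sub>R e) =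
     r *\<^sub>R (J t + Jm t - 2 *\<^sub>R e) - (J (J Y) + Y) - (Jm (Jm Y) + Y) - Jm (J Y - Jm Y)"
    by (simp add: x_def lin algebra_simps scaleR_2) (metis mult.commute scaleR_2 scaleR_scaleR)
  also have "\<dots> \<in> R" by (intro R_closed c t)
  finally have xu: "J x + Jm x - 2 *\<^sub>R (Y + r *\<^sub>R e) \<in> R" .
  define d where "d = J t - Jm t"
  have d: "d \<in> S" unfolding d_def by (intro S_closed J_S Jm_S t)
  have kernel: "\<Omega> Y' (J w - Jm w) = 0" if w: "w \<in> S" for w
    using \<Omega>_cong_R(1)[OF Y'(2) w] \<Omega>_J[OF Y'(1) w] \<Omega>_Jm[OF Y'(1) w] by (simp add: lin)
  have diag: "\<Omega> e d = 0"
  proof -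
    have "2 * \<Omega> e d = \<Omega> (J t + Jm t) d"
      using \<Omega>_cong_R(1)[OF t(2) d] by (simp add: lin)
    also have "\<dots> = 0"
      using \<Omega>_J[of t "Jm t"] \<Omega>_Jm[of t "J t"] \<Omega>_J_J[of t t] \<Omega>_Jm_Jm[of t t] \<Omega>_skew[of t t]
        \<Omega>_skew[of "J t" "J t"] \<Omega>_skew[of "Jm t" "Jm t"] t
      by (simp add: d_def lin J_S Jm_S)
    finally show ?thesis by simp
  qed
  have "J (J Y) - Jm (J Y) = (J (J Y) + Y) - (Jm (Jm Y) + Y) - Jm (J Y - Jm Y)"
    by (simp add: lin)
  also have "\<dots> \<in> R" by (intro R_closed c)
  finally have "J (J Y) - Jm (J Y) \<in> R" .
  then have "\<Omega> e (J x - Jm x) = 0"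
    using \<Omega>_R[OF e, of "J (J Y) - Jm (J Y)"] diag by (simp add: x_def d_def lin algebra_simps)
  then have "\<Omega> (Y' + s *\<^sub>R e) (J x - Jm x) = 0"
    using kernel[OF x] unfolding \<Omega>_left blinfun.add_left blinfun.scaleR_left by simp
  moreover have "Y + r *\<^sub>R e \<in> S" "Y' + s *\<^sub>R e \<in> S" using Y Y' e by (auto simp: S_closed)
  ultimately show ?thesis using poisson1_eq[OF _ _ x xu \<alpha> \<gamma>] by simp
qed

end

section \<open>The standard symplectic form and the reduction by the circle\<close>

lemma i_smult_linear: "linear (\<lambda>v. \<i> *s (v :: complex^'n))"
  by (rule linearI) (auto simp: vec_eq_iff algebra_simps)

lemmas i_smult_simps = linear_add[OF i_smult_linear] linear_diff[OF i_smult_linear]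
  linear_neg[OF i_smult_linear] linear_cmul[OF i_smult_linear]

lemma i_smult_i_smult [simp]: "\<i> *s (\<i> *s v) = - (v :: complex^'n)"
  by (simp add: vec_eq_iff)

text \<open>
  The real inner product is the real part of the Hermitian one.
\<close>

lemma inner_unit_smult: "cmod u = 1 \<Longrightarrow> (u *s v) \<bullet> (u *s w) = v \<bullet> (w :: complex^'n)"
proof -
  assume u: "cmod u = 1"
  have "(u * a) \<bullet> (u * b) = a \<bullet> b" for a b
  proof -
    have "(Re u)\<^sup>2 + (Im u)\<^sup>2 = 1" using u by (simp add: cmod_def)
    moreover have "(u * a) \<bullet> (u * b) = ((Re u)\<^sup>2 + (Im u)\<^sup>2) * (a \<bullet> b)"
      by (simp add: inner_complex_def power2_eq_square algebra_simps)
    ultimately show ?thesis by simp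
  qed
  then show ?thesis by (simp add: inner_vec_def)
qed

lemma inner_i_smult [simp]: "(\<i> *s v) \<bullet> (\<i> *s w) = v \<bullet> (w :: complex^'n)"
  by (rule inner_unit_smult) simp

lemma inner_i_smult_left: "(\<i> *s v) \<bullet> w = - v \<bullet> (\<i> *s (w :: complex^'n))"
  using inner_i_smult[of v "\<i> *s w"] by simp

lemma inner_i_smult_self [simp]: "(\<i> *s v) \<bullet> v = 0" "v \<bullet> (\<i> *s v) = 0" for v :: "complex^'n"
  using inner_i_smult_left[of v v] by (auto simp: inner_commute)

lemma Omega0_apply: "Omega0 v w = (\<i> *s v) \<bullet> w"
proof -
  have *: "Re (\<Sum>j\<in>UNIV. \<i>/2 * (v$j * cnj (w$j) - w$j * cnj (v$j))) = (\<i> *s v) \<bullet> w" for w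
    unfolding Re_sum inner_vec_def
    by (intro sum.cong) (simp_all add: inner_complex_def field_simps)
  then show ?thesis
    unfolding Omega0_def by (simp add: bounded_linear_Blinfun_apply bounded_linear_inner_right)
qed

lemma Omega0_linear: "linear Omega0"
  by (rule linearI)
     (auto simp: Omega0_apply i_smult_simps blinfun.add_left blinfun.scaleR_left inner_add_left
        intro!: blinfun_eqI)

lemma Omega0_skew: "Omega0 v w = - Omega0 w v"
  using inner_i_smult_left[of w v] by (simp add: Omega0_apply inner_commute)

lemma tamed_quotient_at:
  fixes M :: "(complex^'n) qman"
  assumes "gk_symplectic M (\<lambda>_. Omega0) J" "z \<in> pts M"
    and "subspace (tang M z)" "subspace (vert M z)" "vert M z \<subseteq> tang M z"
    and "\<And>x r. x \<in> tang M z \<Longrightarrow> r \<in> vert M z \<Longrightarrow> Omega0 x r = 0"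
  shows "tamed_quotient (tang M z) (vert M z) Omega0 (J z)"
proof (rule tamed_quotient.intro)
  show "linear (Omega0 :: complex^'n \<Rightarrow> _)" by (rule Omega0_linear)
  show "Omega0 x y = - Omega0 y x" for x y :: "complex^'n" by (rule Omega0_skew)
qed (use assms in \<open>auto simp: gk_symplectic_def complex_structure_def endo_field_def
       image_subset_iff Omega0_linear\<close>)

lemma tamed_Cspace: "gk_symplectic Cspace (\<lambda>_. Omega0) J \<Longrightarrow> tamed_quotient UNIV {0} Omega0 (J z)"
  using tamed_quotient_at[of Cspace J z] by (simp add: Cspace_def subspace_single_0)

lemma CP_simps [simp]: "pts CP = sphere 0 1" "tang CP z = {v. z \<bullet> v = 0}" "vert CP z = span {\<i> *s z}"
  "grp CP = {\<lambda>w. u *s w | u. cmod u = 1}"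
  by (auto simp: CP_def Xgen_def)

lemma vert_CP_iff: "v \<in> span {\<i> *s z} \<longleftrightarrow> (\<exists>t. v = t *\<^sub>R (\<i> *s z))"
  by (auto simp: span_singleton)

lemma tamed_CP:
  assumes "gk_symplectic CP fubini_study I" "z \<in> sphere 0 1"
  shows "tamed_quotient {v. z \<bullet> v = 0} (span {\<i> *s z}) Omega0 (I z)"
proof -
  have "gk_symplectic CP (\<lambda>_. Omega0) I" using assms(1) by (simp add: fubini_study_def[abs_def])
  moreover have "Omega0 x r = 0" if "z \<bullet> x = 0" "r \<in> span {\<i> *s z}" for x r
    using that by (auto simp: vert_CP_iff Omega0_apply inner_commute[of x])
  moreover have "span {\<i> *s z} \<subseteq> {v. z \<bullet> v = 0}" by (auto simp: vert_CP_iff)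
  ultimately show ?thesis
    using tamed_quotient_at[of CP I z] assms(2) by (simp add: subspace_hyperplane)
qed

lemma pairing_linear_right: "linear (pairing e)"
  by (rule linearI) (auto simp: pairing_def blinfun.add_right blinfun.scaleR_right
      blinfun.add_left blinfun.scaleR_left field_simps)

lemma perp_KhatI:
  fixes e :: "(complex^'n) gvec"
  assumes "snd e (\<i> *s z) = bfield UNIV Omega0 (J z) (\<i> *s z) (fst e)" "z \<bullet> fst e = 0"
  shows "e \<in> perp (Khat J z)"
proof -
  define G where "G = {(Xgen z, - bfield UNIV Omega0 (J z) (Xgen z)), (0, blinfun_inner_right z)}"
  have "pairing e \<kappa> = 0" if "\<kappa> \<in> span G" for \<kappa>
    using that
  proof (induction rule: span_induct)
    case base
    show ?case using linear_subspace_vimage[OF pairing_linear_right subspace_single_0, of e]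
      by (simp add: vimage_def)
  next
    case (step \<kappa>)
    then show ?case using assms by (auto simp: G_def pairing_def Xgen_def blinfun.minus_left)
  qed
  then show ?thesis by (auto simp: perp_def Khat_def G_def)
qed

text \<open>
  Elements of an eigenbundle that are already orthogonal to \<open>Khat\<close> need no correction.
\<close>

lemma reduced_bundle_horizontal:
  "l \<in> L \<Longrightarrow> l \<in> perp (Khat J z) \<times> perp (Khat J z) \<Longrightarrow> l \<in> reduced_bundle (Khat J z) L"
proof -
  assume "l \<in> L" "l \<in> perp (Khat J z) \<times> perp (Khat J z)"
  moreover have "0 \<in> Khat J z \<times> Khat J z"
    by (simp add: mem_Times_iff Khat_def span_zero)
  ultimately show ?thesis
    unfolding reduced_bundle_def by (metis (mono_tags, lifting) CollectI IntI add_0_right)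
qed

text \<open>
  For horizontal \<open>v\<close> the pair \<open>(v + g v, J v + g J v)\<close> lies in both eigenbundles and is orthogonal to
  \<open>Khat\<close>, since \<open>(g - b) X = - \<Omega> J\<^sub>- X\<close> is, up to sign, \<open>df \<circ> J\<^sub>+\<close>.  A splitting moves tangent parts only
  by multiples of \<open>X\<close>, so \<open>eigenbundles_imp_J\<close> downstairs compares \<open>I\<close> with \<open>J\<close>.
\<close>

lemma gk_reduction_on_horizontal:
  assumes J: "gk_symplectic Cspace (\<lambda>_. Omega0) J" and red: "gk_reduction J I"
    and z: "norm z = 1" and v: "z \<bullet> v = 0" "z \<bullet> J z v = 0"
  shows "I z v - J z v \<in> span {\<i> *s z}"
proof -
  interpret up: tamed_quotient UNIV "{0}" Omega0 "J z" using J by (rule tamed_Cspace)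
  interpret dn: tamed_quotient "{v. z \<bullet> v = 0}" "span {\<i> *s z}" Omega0 "I z"
    using red z by (intro tamed_CP) (auto simp: gk_reduction_def)
  define gv where "gv x = (x, up.g x)" for x
  have JJ: "J z (J z v) = - v"
    using up.J_J[of v] by (simp add: eq_neg_iff_add_eq_0)
  have horizontal: "gv x \<in> perp (Khat J z)" if "z \<bullet> x = 0" "z \<bullet> J z x = 0" for x
  proof (rule perp_KhatI)
    have "up.g x (\<i> *s z) - bfield UNIV Omega0 (J z) (\<i> *s z) x
        = - Omega0 (Jminus UNIV Omega0 (J z) (\<i> *s z)) x"
      unfolding up.g_sym[of x "\<i> *s z", simplified]
      by (simp add: up.g_apply bfield_def up.lin field_simps)
    also have "\<dots> = Omega0 (\<i> *s z) (J z x)" using up.\<Omega>_Jm by simp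
    also have "\<dots> = 0" using that by (simp add: Omega0_apply)
    finally show "snd (gv x) (\<i> *s z) = bfield UNIV Omega0 (J z) (\<i> *s z) (fst (gv x))"
      by (simp add: gv_def)
  qed (simp add: gv_def that)
  have perp: "gv v \<in> perp (Khat J z)" "gv (J z v) \<in> perp (Khat J z)"
    using horizontal v JJ by auto
  have "z \<in> pts CP" using z by simp
  with red have "\<exists>\<Phi>. splitting J z \<Phi> \<and>
        (\<forall>l \<in> perp (Khat J z) \<times> perp (Khat J z).
           (l \<in> reduced_bundle (Khat J z) (eigenbundle UNIV {0} (GJ1 UNIV Omega0 (J z))) \<longleftrightarrow>
            map_prod \<Phi> \<Phi> l \<in>
              eigenbundle (tang CP z) (vert CP z) (GJ1 (tang CP z) (fubini_study z) (I z))) \<and>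
           (l \<in> reduced_bundle (Khat J z) (eigenbundle UNIV {0} (GJ2 UNIV Omega0 (J z))) \<longleftrightarrow>
            map_prod \<Phi> \<Phi> l \<in>
              eigenbundle (tang CP z) (vert CP z) (GJ2 (tang CP z) (fubini_study z) (I z))))"
    unfolding gk_reduction_def by blast
  then obtain \<Phi> where \<Phi>: "splitting J z \<Phi>"
    and red1: "\<And>l. l \<in> perp (Khat J z) \<times> perp (Khat J z) \<Longrightarrow>
        l \<in> reduced_bundle (Khat J z) (eigenbundle UNIV {0} (GJ1 UNIV Omega0 (J z))) \<Longrightarrow>
        map_prod \<Phi> \<Phi> l \<in> eigenbundle (tang CP z) (vert CP z) (GJ1 (tang CP z) (fubini_study z) (I z))"
    and red2: "\<And>l. l \<in> perp (Khat J z) \<times> perp (Khat J z) \<Longrightarrow>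
        l \<in> reduced_bundle (Khat J z) (eigenbundle UNIV {0} (GJ2 UNIV Omega0 (J z))) \<Longrightarrow>
        map_prod \<Phi> \<Phi> l \<in> eigenbundle (tang CP z) (vert CP z) (GJ2 (tang CP z) (fubini_study z) (I z))"
    by blast
  let ?l = "(gv v, gv (J z v))"
  have "?l \<in> perp (Khat J z) \<times> perp (Khat J z)" using perp by simp
  note reduced = red1[OF this reduced_bundle_horizontal[OF _ this]]
    red2[OF this reduced_bundle_horizontal[OF _ this]]
  have "fubini_study z = Omega0" by (simp add: fubini_study_def fun_eq_iff)
  then have "(\<Phi> (gv v), \<Phi> (gv (J z v))) \<in> eigenbundle {v. z \<bullet> v = 0} (span {\<i> *s z}) (GJ1 {v. z \<bullet> v = 0} Omega0 (I z))"
    "(\<Phi> (gv v), \<Phi> (gv (J z v))) \<in> eigenbundle {v. z \<bullet> v = 0} (span {\<i> *s z}) (GJ2 {v. z \<bullet> v = 0} Omega0 (I z))"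
    using reduced up.graph_in_eigenbundles[of v] by (simp_all add: gv_def)
  then have 1: "fst (\<Phi> (gv (J z v))) - I z (fst (\<Phi> (gv v))) \<in> span {\<i> *s z}"
    using dn.eigenbundles_imp_J by blast
  have 2: "fst (\<Phi> (gv v)) - v \<in> span {\<i> *s z}" "fst (\<Phi> (gv (J z v))) - J z v \<in> span {\<i> *s z}"
    using \<Phi> perp unfolding splitting_def CP_simps by (auto simp: gv_def)
  have "(fst (\<Phi> (gv (J z v))) - J z v) - I z (fst (\<Phi> (gv v)) - v)
      - (fst (\<Phi> (gv (J z v))) - I z (fst (\<Phi> (gv v)))) \<in> span {\<i> *s z}"
    by (intro dn.R_closed dn.J_R 1 2)
  then show ?thesis by (simp add: dn.lin)
qed

text \<open>
  \<open>df (J X) = - \<Omega>(X, J X)\<close> is negative by taming, so a multiple of \<open>X\<close> corrects \<open>df (J v)\<close> to zero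
  without changing \<open>df v\<close>.
\<close>

lemma horizontal_decomposition:
  assumes J: "gk_symplectic Cspace (\<lambda>_. Omega0) J" and z: "norm z = 1" and v: "z \<bullet> v = 0"
  obtains h t where "v = h + t *\<^sub>R (\<i> *s z)" "z \<bullet> h = 0" "z \<bullet> J z h = 0"
proof -
  interpret up: tamed_quotient UNIV "{0}" Omega0 "J z" using J by (rule tamed_Cspace)
  let ?X = "\<i> *s z"
  have "z \<noteq> 0" using z by auto
  then have "?X \<noteq> 0" by (simp add: vec_eq_iff)
  then have "z \<bullet> J z ?X < 0"
    using up.tamed[of ?X] by (simp add: Omega0_apply)
  then show ?thesis
    using v by (intro that[of "v - (z \<bullet> J z v / (z \<bullet> J z ?X)) *\<^sub>R ?X" "z \<bullet> J z v / (z \<bullet> J z ?X)"])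
      (auto simp: inner_diff_right up.lin)
qed

section \<open>Smooth functions and differentials on projective space\<close>

lemma Ck_on_const: "Ck_on m UNIV (\<lambda>_. c)"
  by (induction m arbitrary: c) (auto simp: frechet_derivative_const)

lemma smooth_on_UNIV_iff: "smooth_on UNIV f \<longleftrightarrow> (\<forall>m. Ck_on m UNIV f)"
  by (simp add: smooth_on_def)

lemma Ck_on_bounded_linear:
  assumes "bounded_linear f"
  shows "Ck_on m UNIV f"
proof (cases m)
  case (Suc m')
  have "frechet_derivative f (at x) = f" for x
    using frechet_derivative_at[OF bounded_linear_imp_has_derivative[OF assms]] by simp
  then show ?thesis
    using Suc assms by (auto simp: Ck_on_const bounded_linear_imp_differentiable_on)
qed (use assms in \<open>simp add: linear_continuous_on\<close>)

lemma Ck_on_quadratic: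
  assumes B: "bounded_bilinear B"
  shows "Ck_on m UNIV (\<lambda>x. B x x)"
proof (cases m)
  case 0
  have "continuous_on UNIV (\<lambda>x. B x x)" 
    by (intro bounded_bilinear.continuous_on[OF B] continuous_intros)
  then show ?thesis using 0 by simp
next
  case (Suc m')
  have d: "((\<lambda>x. B x x) has_derivative (\<lambda>v. B x v + B v x)) (at x)" for x
    by (rule bounded_bilinear.FDERIV[OF B]) (auto intro: derivative_intros)
  then have "frechet_derivative (\<lambda>x. B x x) (at x) v = B x v + B v x" for x v
    by (metis frechet_derivative_at)
  moreover have "bounded_linear (\<lambda>x. B x v + B v x)" for v
    by (intro bounded_linear_add bounded_bilinear.bounded_linear_left[OF B] bounded_bilinear.bounded_linear_right[OF B])
  ultimately show ?thesis
    using Suc differentiableI[OF d] by (simp add: Ck_on_bounded_linear differentiable_on_def)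
qed

lemma smooth_on_differentiable:
  assumes "smooth_on U f" "z \<in> U"
  shows "f differentiable (at z)"
proof -
  have "open U" "Ck_on (Suc 0) U f" using assms(1) by (auto simp: smooth_on_def)
  then show ?thesis
    using assms(2) at_within_open[of z U] by (auto simp: differentiable_on_def)
qed

text \<open>
  The lifts agree on the sphere, hence along a great circle with initial velocity proportional
  to \<open>v\<close>.
\<close>

lemma lifts_CP_derivative:
  assumes f: "lifts CP F f" and g: "lifts CP F g" and z: "norm z = 1" and v: "z \<bullet> v = 0"
  shows "frechet_derivative f (at z) v = frechet_derivative g (at z) v"
proof -
  \<comment> \<open>The great circle needs a unit vector; for \<open>v = 0\<close> a constant curve serves.\<close>
  define u where "u = (if v = 0 then 0 else (1 / norm v) *\<^sub>R v)"
  have vu: "v = norm v *\<^sub>R u" by (simp add: u_def)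
  define \<gamma> where "\<gamma> t = (if v = 0 then z else cos t *\<^sub>R z + sin t *\<^sub>R u)" for t
  have on_sphere: "\<gamma> t \<in> pts CP" for t
  proof (cases "v = 0")
    case False
    then have "u \<bullet> u = 1" "z \<bullet> u = 0" "z \<bullet> z = 1"
      using v z by (auto simp: u_def dot_square_norm power2_eq_square)
    then have "(norm (\<gamma> t))\<^sup>2 = 1"
      using False unfolding power2_norm_eq_inner \<gamma>_def
      by (simp add: inner_add_left inner_add_right inner_commute[of u z] power2_eq_square[symmetric])
    then show ?thesis using norm_ge_zero[of "\<gamma> t"] by (simp add: power2_eq_1_iff)
  qed (simp add: \<gamma>_def z)
  have \<gamma>0: "\<gamma> 0 = z" by (simp add: \<gamma>_def)
  have d\<gamma>: "(\<gamma> has_vector_derivative u) (at 0)"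
  proof (cases "v = 0")
    case False
    have "((\<lambda>t. cos t *\<^sub>R z + sin t *\<^sub>R u) has_vector_derivative (- sin 0 *\<^sub>R z + cos 0 *\<^sub>R u)) (at 0)"
      by (auto intro!: derivative_eq_intros)
    then show ?thesis using False by (simp add: \<gamma>_def[abs_def])
  qed (simp add: \<gamma>_def[abs_def] u_def)
  have diff: "h differentiable (at z)" if "lifts CP F h" for h
    using that z smooth_on_differentiable[of _ h z] by (force simp: lifts_def)
  have chain: "((h \<circ> \<gamma>) has_vector_derivative frechet_derivative h (at z) u) (at 0)"
    if "lifts CP F h" for h
  proof -
    have "(h has_derivative frechet_derivative h (at z)) (at (\<gamma> 0))"
      using diff[OF that] by (simp add: \<gamma>0 frechet_derivative_works)
    from vector_derivative_diff_chain_within[OF d\<gamma> has_derivative_at_withinI[OF this]] show ?thesis .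
  qed
  have "f \<circ> \<gamma> = g \<circ> \<gamma>"
    using f g on_sphere by (auto simp: lifts_def simp del: CP_simps)
  then have "frechet_derivative f (at z) u = frechet_derivative g (at z) u"
    using vector_derivative_unique_at[OF chain[OF f]] chain[OF g] by simp
  moreover have "linear (frechet_derivative h (at z))" if "lifts CP F h" for h
    using diff[OF that] by (rule linear_frechet_derivative)
  ultimately show ?thesis
    using f g by (subst (1 2) vu) (simp add: linear_cmul)
qed

lemma dfun_CP:
  assumes f: "lifts CP F f" and z: "norm z = 1" and v: "z \<bullet> v = 0"
  shows "dfun CP F z v = frechet_derivative f (at z) v"
proof -
  define h where "h = (SOME f. lifts CP F f)"
  have "\<exists>f. lifts CP F f" using f by blast
  then have h: "lifts CP F h" unfolding h_def by (rule someI_ex)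
  then have "h differentiable (at z)"
    using z smooth_on_differentiable[of _ h z] by (force simp: lifts_def)
  then have "bounded_linear (frechet_derivative h (at z))"
    by (metis frechet_derivative_works has_derivative_bounded_linear)
  then show ?thesis
    unfolding dfun_def h_def[symmetric]
    using lifts_CP_derivative[OF h f z v] by (simp add: bounded_linear_Blinfun_apply)
qed

section \<open>The toric structure on the coordinates not involved in the bivector\<close>

text \<open>
  The toric formula prescribes \<open>J\<close> only on the fields \<open>\<partial>\<^sub>\<nu>\<close>, which span half of the space; \<open>J\<^sup>2 = - 1\<close>
  determines it on the image of this half, which is the other half.  The same argument turns any
  intertwining relation on the \<open>\<partial>\<^sub>\<nu>\<close> into one on the whole space.
\<close>

lemma intertwines_if_on_generators:
  fixes A :: "'v::real_vector \<Rightarrow> 'w::real_vector"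
  assumes A: "linear A" and j: "linear j" "linear j'"
    and sq: "\<And>x. j (j x) = - x" "\<And>x. j' (j' x) = - x"
    and spans: "\<And>v. \<exists>n\<in>span G. \<exists>m\<in>span G. v = n + j m"
    and gen: "\<And>x. x \<in> G \<Longrightarrow> j' (A x) = A (j x)"
  shows "j' (A v) = A (j v)"
proof -
  have on_span: "j' (A n) = A (j n)" if "n \<in> span G" for n
    using linear_eq_on[OF linear_compose[OF A j(2)] linear_compose[OF j(1) A] that] gen by simp
  obtain n m where nm: "n \<in> span G" "m \<in> span G" "v = n + j m" using spans by blast
  have "j' (A (j m)) = A (j (j m))"
    unfolding on_span[OF nm(2), symmetric] sq by (simp add: linear_neg[OF A])
  then show ?thesis
    using on_span[OF nm(1)] by (simp add: nm(3) linear_add[OF A] linear_add[OF j(1)] linear_add[OF j(2)])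
qed

text \<open>
  An approximation of \<open>z\<close> by points of the open torus orbit that keeps the nonzero coordinates.  Points
  which share some coordinates have approximations which share them.
\<close>

definition off_axes :: "complex^'n \<Rightarrow> nat \<Rightarrow> complex^'n" where
  "off_axes z m = (\<chi> i. if z$i = 0 then inverse (of_nat (Suc m)) else z$i)"

lemma off_axes_nonzero: "off_axes z m $ i \<noteq> 0"
  by (simp add: off_axes_def del: of_nat_Suc)

lemma off_axes_tendsto: "off_axes z \<longlonglongrightarrow> z"
proof (rule vec_tendstoI)
  fix i
  show "(\<lambda>m. off_axes z m $ i) \<longlonglongrightarrow> z $ i"
    using LIMSEQ_inverse_real_of_nat[THEN tendsto_of_real, where 'a=complex]
    by (cases "z $ i = 0") (simp_all add: off_axes_def del: of_nat_Suc)
qed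

lemma eq_by_density:
  fixes f g :: "complex^'n \<Rightarrow> 'b::t2_space"
  assumes "continuous_on UNIV f" "continuous_on UNIV g"
    and "\<And>m. f (off_axes z m) = g (off_axes w m)"
  shows "f z = g w"
proof -
  have "(\<lambda>m. f (off_axes z m)) \<longlonglongrightarrow> f z" "(\<lambda>m. g (off_axes w m)) \<longlonglongrightarrow> g w"
    using assms(1,2)
    by (auto simp: continuous_on_eq_continuous_at intro: isCont_tendsto_compose[OF _ off_axes_tendsto])
  then show ?thesis using assms(3) LIMSEQ_unique by auto
qed

lemma d_theta_eq: "z $ j \<noteq> 0 \<Longrightarrow> d_theta z j = \<i> *s ((cmod (z$j))\<^sup>2 *\<^sub>R d_nu z j)"
  by (auto simp: d_theta_def d_nu_def axis_def vec_eq_iff scaleR_conv_of_real[where 'a=complex])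

lemma d_nu_component: "d_nu z l $ i = (if i = l then z$l / of_real ((cmod (z$l))\<^sup>2) else 0)"
  by (simp add: d_nu_def axis_def)

lemma d_nu_spans:
  assumes z: "\<And>i. z $ i \<noteq> 0"
  shows "\<exists>n\<in>span (range (d_nu z)). \<exists>m\<in>span (range (d_nu z)). v = n + \<i> *s m"
proof -
  \<comment> \<open>The factor of \<open>z\<^sub>l / |z\<^sub>l|\<^sup>2\<close> in \<open>v\<^sub>l\<close>; its real part goes with \<open>\<partial>\<^sub>\<nu>\<close>, its imaginary part with \<open>\<i> \<partial>\<^sub>\<nu>\<close>.\<close>
  define a where "a l = v $ l * cnj (z $ l)" for l
  have "v = (\<Sum>l\<in>UNIV. Re (a l) *\<^sub>R d_nu z l) + \<i> *s (\<Sum>l\<in>UNIV. Im (a l) *\<^sub>R d_nu z l)"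
  proof (rule vec_eq_iff[THEN iffD2], rule allI)
    fix i
    have "v $ i = a i * (z $ i / of_real ((cmod (z$i))\<^sup>2))"
      using z[of i] unfolding a_def complex_norm_square by simp
    also have "\<dots> = (of_real (Re (a i)) + \<i> * of_real (Im (a i))) * (z $ i / of_real ((cmod (z$i))\<^sup>2))"
      using complex_eq[of "a i"] by simp
    finally show "v $ i = ((\<Sum>l\<in>UNIV. Re (a l) *\<^sub>R d_nu z l) + \<i> *s (\<Sum>l\<in>UNIV. Im (a l) *\<^sub>R d_nu z l)) $ i"
      by (simp add: d_nu_component scaleR_conv_of_real[where 'a=complex] if_distrib distrib_right mult.assoc add_divide_distrib cong: if_cong)
  qed
  moreover have "(\<Sum>l\<in>UNIV. Re (a l) *\<^sub>R d_nu z l) \<in> span (range (d_nu z))"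
    "(\<Sum>l\<in>UNIV. Im (a l) *\<^sub>R d_nu z l) \<in> span (range (d_nu z))"
    by (intro span_sum span_scale span_base rangeI)+
  ultimately show ?thesis by blast
qed

locale toric =
  fixes label :: "'n::finite \<Rightarrow> nat" and k :: nat and c :: "nat \<Rightarrow> nat \<Rightarrow> real"
    and J :: "complex^'n \<Rightarrow> (complex^'n) \<Rightarrow>\<^sub>L (complex^'n)"
  assumes toric: "toric_gk label k c J"
begin

lemma gk: "gk_symplectic Cspace (\<lambda>_. Omega0) J"
  using toric by (simp add: toric_gk_def)

lemma J_J: "J z (J z v) = - v"
proof -
  interpret tamed_quotient UNIV "{0}" Omega0 "J z" using gk by (rule tamed_Cspace)
  show ?thesis using J_J[of v] by (simp add: eq_neg_iff_add_eq_0)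
qed

lemma J_linear: "linear (J z)"
  by (simp add: blinfun.bounded_linear_right bounded_linear.linear)

lemma J_continuous: "continuous_on UNIV (\<lambda>z. J z v)"
proof -
  have "vfield Cspace (\<lambda>_. v)"
    by (auto simp: vfield_def Cspace_def smooth_on_UNIV_iff Ck_on_const intro!: exI[of _ UNIV])
  moreover have "endo_field Cspace J"
    using gk by (simp add: gk_symplectic_def complex_structure_def)
  ultimately obtain Y where Y: "vfield Cspace Y" "\<forall>z\<in>pts Cspace. Y z - J z v \<in> vert Cspace z"
    unfolding endo_field_def by blast
  then have "Y = (\<lambda>z. J z v)" by (auto simp: Cspace_def)
  moreover obtain U where "pts Cspace \<subseteq> U" "smooth_on U Y" using Y(1) unfolding vfield_def by blast
  then have "continuous_on UNIV Y"
    by (auto simp: Cspace_def smooth_on_def top.extremum_unique dest!: spec[of _ 0])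
  ultimately show ?thesis by simp
qed

lemma J_d_nu_component:
  assumes "\<And>i. z $ i \<noteq> 0"
  shows "J z (d_nu z l) $ i = phi label k c z l i *\<^sub>R (\<i> * z $ i)"
proof -
  have "J z (d_nu z l) = (\<Sum>j\<in>UNIV. phi label k c z l j *\<^sub>R d_theta z j)"
    using toric assms by (simp add: toric_gk_def)
  then show ?thesis
    by (simp add: d_theta_def axis_def if_distrib cong: if_cong)
qed

text \<open>
  The \<open>\<partial>\<^sub>\<theta>\<close> span \<open>\<i> N\<close>, where \<open>N\<close> is the span of the \<open>\<partial>\<^sub>\<nu>\<close>.  The toric formula gives \<open>J N \<subseteq> \<i> N\<close>; since
  \<open>J\<close> is injective, the two have the same dimension and coincide.
\<close>

lemma d_nu_spans_J:
  assumes z: "\<And>i. z $ i \<noteq> 0"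
  shows "\<exists>n\<in>span (range (d_nu z)). \<exists>m\<in>span (range (d_nu z)). v = n + J z m"
proof -
  let ?N = "span (range (d_nu z))"
  have "J z (d_nu z l) \<in> (*s) \<i> ` ?N" for l
  proof -
    have "J z (d_nu z l) = (\<Sum>j\<in>UNIV. phi label k c z l j *\<^sub>R d_theta z j)"
      using toric z by (simp add: toric_gk_def)
    also have "\<dots> = \<i> *s (\<Sum>j\<in>UNIV. (phi label k c z l j * (cmod (z$j))\<^sup>2) *\<^sub>R d_nu z j)"
      by (simp add: linear_sum[OF i_smult_linear] linear_cmul[OF i_smult_linear] d_theta_eq z)
    also have "\<dots> \<in> (*s) \<i> ` ?N"
      by (intro imageI span_sum span_scale span_base rangeI)
    finally show ?thesis .
  qed
  then have "J z ` range (d_nu z) \<subseteq> (*s) \<i> ` ?N" by auto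
  then have "span (J z ` range (d_nu z)) \<subseteq> (*s) \<i> ` ?N"
    by (rule span_minimal[OF _ linear_subspace_image[OF i_smult_linear subspace_span]])
  then have sub: "J z ` ?N \<subseteq> (*s) \<i> ` ?N"
    by (simp only: linear_span_image[OF J_linear])
  have "inj (J z)" using J_J by (metis injI neg_equal_iff_equal)
  then have "dim (J z ` ?N) = dim ?N"
    by (intro dim_image_eq[OF J_linear]) (rule inj_on_subset[OF _ subset_UNIV])
  moreover have "dim ((*s) \<i> ` ?N) \<le> dim ?N" by (rule dim_image_le[OF i_smult_linear])
  ultimately have "J z ` ?N = (*s) \<i> ` ?N"
    using sub by (intro subspace_dim_equal linear_subspace_image J_linear i_smult_linear subspace_span) auto
  obtain n m where nm: "n \<in> ?N" "m \<in> ?N" "v = n + \<i> *s m"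
    using d_nu_spans[OF z] by blast
  obtain m' where "m' \<in> ?N" "\<i> *s m = J z m'"
    using \<open>J z ` ?N = (*s) \<i> ` ?N\<close> imageI[OF nm(2), of "(*s) \<i>"] by auto
  with nm show ?thesis by auto
qed

definition block :: "complex^'n \<Rightarrow> complex^'n" where
  "block v = (\<chi> i. if k \<le> label i then v $ i else 0)"

lemma block_linear: "linear block"
  by (rule linearI) (auto simp: block_def vec_eq_iff)

text \<open>
  Indices outside the range of \<open>c\<close> meet only the diagonal part of \<open>phi\<close>, as for the flat structure.
\<close>

lemma phi_block:
  assumes "0 < k" "k \<le> label i \<or> k \<le> label l"
  shows "phi label k c z l i = (if l = i then 1 / (cmod (z$l))\<^sup>2 else 0)"
  using assms by (auto simp: phi_def)

lemma J_d_nu_block_component: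
  assumes "0 < k" "\<And>i. z $ i \<noteq> 0" "k \<le> label i \<or> k \<le> label l"
  shows "J z (d_nu z l) $ i = \<i> * d_nu z l $ i"
  unfolding J_d_nu_component[OF assms(2)] phi_block[OF assms(1,3)] d_nu_component
  by (simp add: scaleR_conv_of_real)

text \<open>
  Both sides are compatible with the complex structures \<open>J\<close> and \<open>\<i>\<close>, so it suffices to compare them on
  the \<open>\<partial>\<^sub>\<nu>\<close> over the open torus orbit.
\<close>

lemma block_J:
  assumes k: "0 < k"
  shows "block (J z v) = \<i> *s block v"
proof (rule eq_by_density[where f = "\<lambda>z. block (J z v)" and g = "\<lambda>_. \<i> *s block v" and w = z])
  show "continuous_on UNIV (\<lambda>z. block (J z v))"
    by (rule bounded_linear.continuous_on[OF _ J_continuous])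
       (use block_linear in \<open>simp add: linear_conv_bounded_linear\<close>)
  fix m
  let ?z = "off_axes z m"
  have "\<i> *s block v = block (J ?z v)"
  proof (rule intertwines_if_on_generators[OF block_linear J_linear i_smult_linear J_J])
    show "\<exists>n\<in>span (range (d_nu ?z)). \<exists>m\<in>span (range (d_nu ?z)). v = n + J ?z m" for v
      by (rule d_nu_spans_J) (rule off_axes_nonzero)
    fix x assume "x \<in> range (d_nu ?z)"
    then obtain l where x: "x = d_nu ?z l" by auto
    show "\<i> *s block x = block (J ?z x)"
      unfolding x by (simp add: block_def vec_eq_iff J_d_nu_block_component[OF k off_axes_nonzero])
  qed simp
  then show "block (J ?z v) = \<i> *s block v" by simp
qed simp

lemma J_block:
  assumes k: "0 < k"
  shows "J z (block v) = \<i> *s block v"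
proof (rule eq_by_density[where f = "\<lambda>z. J z (block v)" and g = "\<lambda>_. \<i> *s block v" and w = z])
  show "continuous_on UNIV (\<lambda>z. J z (block v))" by (rule J_continuous)
  fix m
  let ?z = "off_axes z m"
  have "J ?z (block v) = block (\<i> *s v)"
  proof (rule intertwines_if_on_generators[OF block_linear i_smult_linear J_linear _ J_J])
    show "\<exists>n\<in>span (range (d_nu ?z)). \<exists>m\<in>span (range (d_nu ?z)). v = n + \<i> *s m" for v
      by (rule d_nu_spans) (rule off_axes_nonzero)
    show "J ?z (block x) = block (\<i> *s x)" if x_range: "x \<in> range (d_nu ?z)" for x
    proof -
      obtain l where x: "x = d_nu ?z l" using x_range by auto
      show ?thesis
      proof (cases "k \<le> label l")
        case True
        then have "block x = x" by (auto simp: x block_def vec_eq_iff d_nu_component)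
        moreover have "J ?z x = block (\<i> *s x)"
          using True unfolding x
          by (simp add: block_def vec_eq_iff J_d_nu_block_component[OF k off_axes_nonzero] d_nu_component)
        ultimately show ?thesis by simp
      next
        case False
        then have "block x = 0" "block (\<i> *s x) = 0" by (auto simp: x block_def vec_eq_iff d_nu_component)
        then show ?thesis by simp
      qed
    qed
  qed simp
  then show "J ?z (block v) = \<i> *s block v" by (simp add: block_def vec_eq_iff)
qed simp

text \<open>
  On a field \<open>\<partial>\<^sub>\<nu>\<close> of the block, \<open>J\<close> is \<open>\<i>\<close> at every point; on the others the toric formula involves the
  coordinates with label below \<open>k\<close> alone.
\<close>

lemma J_cong:
  assumes k: "0 < k" and zw: "\<And>i. label i < k \<Longrightarrow> z $ i = w $ i"
  shows "J z = J w"
proof (rule blinfun_eqI, rule eq_by_density[OF J_continuous J_continuous])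
  fix v m
  let ?z = "off_axes z m" and ?w = "off_axes w m"
  have eq: "?z $ i = ?w $ i" if "label i < k" for i using zw[OF that] by (simp add: off_axes_def)
  have "J ?w (id v) = id (J ?z v)"
  proof (rule intertwines_if_on_generators[OF linear_id J_linear J_linear J_J J_J])
    show "\<exists>n\<in>span (range (d_nu ?z)). \<exists>m\<in>span (range (d_nu ?z)). v = n + J ?z m" for v
      by (rule d_nu_spans_J) (rule off_axes_nonzero)
    fix x assume "x \<in> range (d_nu ?z)"
    then obtain l where x: "x = d_nu ?z l" by auto
    show "J ?w (id x) = id (J ?z x)"
    proof (cases "k \<le> label l")
      case True
      then have "block x = x" by (auto simp: x block_def vec_eq_iff d_nu_component)
      then show ?thesis using J_block[OF k, of _ x] by simp
    next
      case False
      then have x': "x = d_nu ?w l" using eq[of l] by (simp add: x d_nu_def)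
      have "phi label k c ?w l i = phi label k c ?z l i" for i
        using eq[of l] False by (auto simp: phi_def)
      moreover have "phi label k c ?z l i = 0 \<or> ?w $ i = ?z $ i" for i
        using eq[of i] False phi_block[OF k, of i l ?z] by (cases "k \<le> label i") auto
      ultimately have "J ?w (d_nu ?w l) $ i = J ?z (d_nu ?z l) $ i" for i
        unfolding J_d_nu_component[OF off_axes_nonzero] by (metis scaleR_zero_left)
      then have "J ?w (d_nu ?w l) = J ?z (d_nu ?z l)" by (simp add: vec_eq_iff)
      then show ?thesis unfolding id_apply using x x' by metis
    qed
  qed
  then show "J ?z v = J ?w v" by simp
qed

end

section \<open>The group of block unitary matrices\<close>

definition adjoint_matrix :: "complex^'n^'n \<Rightarrow> complex^'n^'n" where
  "adjoint_matrix A = (\<chi> i j. cnj (A$j$i))"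

lemma inner_adjoint_matrix: "(A *v x) \<bullet> y = x \<bullet> (adjoint_matrix A *v y)" for A :: "complex^'n^'n"
proof -
  have *: "(a * b) \<bullet> d = b \<bullet> (cnj a * d)" for a b d :: complex
    by (simp add: inner_complex_def algebra_simps)
  have "(A *v x) \<bullet> y = (\<Sum>i\<in>UNIV. \<Sum>j\<in>UNIV. x$j \<bullet> (cnj (A$i$j) * y$i))"
    by (simp add: inner_vec_def matrix_vector_mult_def inner_sum_left *)
  also have "\<dots> = x \<bullet> (adjoint_matrix A *v y)"
    by (subst sum.swap) (simp add: inner_vec_def matrix_vector_mult_def inner_sum_right adjoint_matrix_def)
  finally show ?thesis .
qed

lemma adjoint_matrix_mult: "adjoint_matrix (A ** B) = adjoint_matrix B ** adjoint_matrix A"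
  by (simp add: adjoint_matrix_def matrix_matrix_mult_def vec_eq_iff mult.commute)

lemma adjoint_adjoint_matrix [simp]: "adjoint_matrix (adjoint_matrix A) = A"
  by (simp add: adjoint_matrix_def vec_eq_iff)

lemma unitary_block_iff:
  "A \<in> unitary_block label k \<longleftrightarrow> adjoint_matrix A ** A = mat 1 \<and>
     (\<forall>i j. label i < k \<or> label j < k \<longrightarrow> A$i$j = (if i = j then 1 else 0))"
  by (simp add: unitary_block_def adjoint_matrix_def)

lemma unitary_block_inner:
  assumes "A \<in> unitary_block label k"
  shows "(A *v x) \<bullet> (A *v y) = x \<bullet> y"
proof -
  have "adjoint_matrix A *v (A *v y) = y"
    using assms by (simp add: unitary_block_iff matrix_vector_mul_assoc)
  then show ?thesis by (simp add: inner_adjoint_matrix)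
qed

lemma unitary_block_norm: "A \<in> unitary_block label k \<Longrightarrow> norm (A *v x) = norm x"
  by (simp add: norm_eq_sqrt_inner unitary_block_inner)

lemma unitary_block_inv:
  assumes "A \<in> unitary_block label k"
  shows "invertible A" "matrix_inv A = adjoint_matrix A" "adjoint_matrix A \<in> unitary_block label k"
    "matrix_inv A *v (A *v x) = x"
proof -
  have 1: "adjoint_matrix A ** A = mat 1" using assms by (simp add: unitary_block_iff)
  then have 2: "A ** adjoint_matrix A = mat 1" by (simp add: matrix_left_right_inverse)
  show "invertible A" using 1 2 by (auto simp: invertible_def)
  have "A ** matrix_inv A = mat 1"
    unfolding matrix_inv_def
    by (rule someI2[where a = "adjoint_matrix A" and Q = "\<lambda>X. A ** X = mat 1"]) (simp_all add: 1 2)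
  then have "adjoint_matrix A ** A ** matrix_inv A = adjoint_matrix A"
    by (simp add: matrix_mul_assoc[symmetric])
  then show 3: "matrix_inv A = adjoint_matrix A" by (simp add: 1)
  show "matrix_inv A *v (A *v x) = x" using 1 3 by (simp add: matrix_vector_mul_assoc)
  show "adjoint_matrix A \<in> unitary_block label k"
    using assms 2 by (auto simp: unitary_block_iff) (auto simp: adjoint_matrix_def)
qed

lemma unitary_block_mult:
  assumes A: "A \<in> unitary_block label k" and B: "B \<in> unitary_block label k"
  shows "A ** B \<in> unitary_block label k"
proof -
  have "adjoint_matrix (A ** B) ** (A ** B) = adjoint_matrix B ** (adjoint_matrix A ** A) ** B"
    by (simp add: adjoint_matrix_mult matrix_mul_assoc)
  also have "\<dots> = mat 1" using A B by (simp add: unitary_block_iff)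
  finally have "adjoint_matrix (A ** B) ** (A ** B) = mat 1" .
  moreover have "(A ** B) $ i $ j = (if i = j then 1 else 0)" if "label i < k \<or> label j < k" for i j
  proof (cases "label i < k")
    case True
    then have "(A ** B) $ i $ j = B $ i $ j"
      using A by (simp add: unitary_block_iff matrix_matrix_mult_def if_distrib[of "\<lambda>x. x * _"] cong: if_cong)
    then show ?thesis using B True by (simp add: unitary_block_iff)
  next
    case False
    then have "B $ l $ j = (if l = j then 1 else 0)" for l
      using B that unfolding unitary_block_iff by blast
    then have "(A ** B) $ i $ j = (\<Sum>l\<in>UNIV. A $ i $ l * (if l = j then 1 else 0))"
      unfolding matrix_matrix_mult_def by simp
    also have "\<dots> = A $ i $ j" by (simp add: if_distrib cong: if_cong)
    finally show ?thesis using A that unfolding unitary_block_iff by metis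
  qed
  ultimately show ?thesis by (simp add: unitary_block_iff)
qed

lemma closed_unitary_block: "closed (unitary_block label k :: (complex^'n^'n) set)"
proof -
  have "unitary_block label k = {A :: complex^'n^'n.
     (\<forall>i j. (\<Sum>l\<in>UNIV. cnj (A$l$i) * A$l$j) = (if i = j then 1 else 0)) \<and>
     (\<forall>i j. label i < k \<or> label j < k \<longrightarrow> A$i$j = (if i = j then 1 else 0))}"
    by (auto simp: unitary_block_def matrix_matrix_mult_def vec_eq_iff mat_def)
  moreover have "closed \<dots>"
    by (intro closed_Collect_conj closed_Collect_all closed_Collect_imp closed_Collect_eq
        continuous_intros open_Collect_const)
  ultimately show ?thesis by simp
qed

lemma bounded_unitary_block: "bounded (unitary_block label k :: (complex^'n^'n) set)"
proof (rule boundedI)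
  fix A :: "complex^'n^'n" assume A: "A \<in> unitary_block label k"
  have entry: "norm (A $ i $ j) \<le> 1" for i j
  proof -
    have "A $ i $ j = (A *v axis j 1) $ i" 
      by (simp add: matrix_vector_mult_def axis_def if_distrib cong: if_cong)
    also have "norm \<dots> \<le> norm (A *v axis j 1)" by (rule Finite_Cartesian_Product.norm_nth_le)
    finally show ?thesis using unitary_block_norm[OF A] by (simp add: norm_axis_1)
  qed
  have "norm (A $ i) \<le> real CARD('n)" for i
    using L2_set_le_sum[of UNIV "\<lambda>j. norm (A$i$j)"] sum_mono[of UNIV "\<lambda>j. norm (A$i$j)" "\<lambda>_. 1"] entry
    by (simp add: norm_vec_def)
  then show "norm A \<le> real CARD('n) * real CARD('n)"
    using L2_set_le_sum[of UNIV "\<lambda>i. norm (A$i)"] sum_mono[of UNIV "\<lambda>i. norm (A$i)" "\<lambda>_. real CARD('n)"]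
    by (simp add: norm_vec_def[of A])
qed

lemma compact_unitary_block: "compact_matrix_group (unitary_block label k :: (complex^'n^'n) set)"
  unfolding compact_matrix_group_def
proof (intro conjI ballI)
  show "compact (unitary_block label k)"
    by (simp add: compact_eq_bounded_closed bounded_unitary_block closed_unitary_block)
  show "(mat 1 :: complex^'n^'n) \<in> unitary_block label k"
  proof -
    have "adjoint_matrix (mat 1 :: complex^'n^'n) = mat 1"
      by (simp add: adjoint_matrix_def vec_eq_iff mat_def)
    then show ?thesis by (simp add: unitary_block_iff) (simp add: mat_def)
  qed
qed (auto simp: unitary_block_mult unitary_block_inv)

lemma matrix_vector_bounded_linear:
  "bounded_linear (\<lambda>A :: complex^'n^'n. A *v x)" "bounded_linear ((*v) (A :: complex^'n^'n))"
  unfolding linear_conv_bounded_linear[symmetric]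
  by (auto intro!: linearI simp: matrix_vector_mult_def vec_eq_iff algebra_simps sum.distrib scaleR_sum_right)

text \<open>
  Differentiate the constant components and the constant norm of \<open>\<gamma> t *v x\<close> along a curve \<open>\<gamma>\<close> in the
  group.
\<close>

lemma lie_alg_unitary_block:
  assumes "\<sigma> \<in> lie_alg (unitary_block label k)"
  shows "label i < k \<Longrightarrow> (\<sigma> *v x) $ i = 0" and "x \<bullet> (\<sigma> *v x) = 0"
proof -
  obtain \<gamma> where \<gamma>: "\<And>t::real. \<gamma> t \<in> unitary_block label k" "\<gamma> 0 = mat 1"
    "(\<gamma> has_vector_derivative \<sigma>) (at 0)"
    using assms unfolding lie_alg_def by blast
  have d: "((\<lambda>t. \<gamma> t *v x) has_vector_derivative \<sigma> *v x) (at 0)"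
    by (rule bounded_linear.has_vector_derivative[OF matrix_vector_bounded_linear(1) \<gamma>(3)])
  { assume i: "label i < k"
    have "(\<gamma> t *v x) $ i = x $ i" for t
      using \<gamma>(1)[of t] i by (simp add: unitary_block_iff matrix_vector_mult_def if_distrib[of "\<lambda>x. x * _"] cong: if_cong)
    then have "((\<lambda>t. x $ i) has_vector_derivative (\<sigma> *v x) $ i) (at (0::real))"
      using bounded_linear.has_vector_derivative[OF bounded_linear_vec_nth d, of i] by simp
    then show "(\<sigma> *v x) $ i = 0"
      using has_vector_derivative_const vector_derivative_unique_at by blast }
  have "((\<lambda>t. (\<gamma> t *v x) \<bullet> (\<gamma> t *v x)) has_vector_derivative
      ((\<gamma> 0 *v x) \<bullet> (\<sigma> *v x) + (\<sigma> *v x) \<bullet> (\<gamma> 0 *v x))) (at 0)"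
    by (rule bounded_bilinear.has_vector_derivative[OF bounded_bilinear_inner d d])
  then have "((\<lambda>t. x \<bullet> x) has_vector_derivative (2 * (x \<bullet> (\<sigma> *v x)))) (at (0::real))"
    by (simp add: unitary_block_inner[OF \<gamma>(1)] \<gamma>(2) inner_commute)
  then have "2 * (x \<bullet> (\<sigma> *v x)) = 0"
    using has_vector_derivative_const vector_derivative_unique_at by blast
  then show "x \<bullet> (\<sigma> *v x) = 0" by simp
qed

lemma acts_on_CP:
  fixes label :: "'n::finite \<Rightarrow> nat"
  shows "acts_on CP (unitary_block label k)"
  unfolding acts_on_def
proof (intro ballI conjI)
  fix A and z :: "complex^'n" assume A: "A \<in> unitary_block label k" and z: "z \<in> pts CP"
  show "A *v z \<in> pts CP" using z by (simp add: unitary_block_norm[OF A])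
  show "orbit_of CP (A *v z) = (*v) A ` orbit_of CP z"
    unfolding orbit_of_def image_image CP_simps
    by (auto simp: vector_scalar_commute image_iff) (metis vector_scalar_commute)+
qed

section \<open>The moment map\<close>

text \<open>
  The quadratic moment map \<open>- \<Omega>\<^sub>0(\<sigma> z, z) / 2\<close> of the linear action on \<open>\<complex>\<^sup>n\<^sup>+\<^sup>1\<close>.
\<close>

definition hamiltonian :: "complex^'n^'n \<Rightarrow> complex^'n \<Rightarrow> real" where
  "hamiltonian \<sigma> z = - (1/2) * ((\<i> *s (\<sigma> *v z)) \<bullet> z)"

lemma hamiltonian_smult: "cmod u = 1 \<Longrightarrow> hamiltonian \<sigma> (u *s z) = hamiltonian \<sigma> z"
  using inner_unit_smult[of u "\<i> *s (\<sigma> *v z)" z]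
  by (simp add: hamiltonian_def vector_scalar_commute vector_smult_assoc mult.commute)

lemma hamiltonian_eq: "hamiltonian \<sigma> z = ((- (1/2)) *\<^sub>R (\<i> *s (\<sigma> *v z))) \<bullet> z"
  by (simp add: hamiltonian_def)

lemma hamiltonian_bilinear:
  "bounded_bilinear (\<lambda>x y. ((- (1/2)) *\<^sub>R (\<i> *s (\<sigma> *v x))) \<bullet> (y :: complex^'n))"
  for \<sigma> :: "complex^'n^'n"
proof -
  have "bounded_linear (\<lambda>x. \<i> *s (\<sigma> *v (x :: complex^'n)))"
    using linear_compose[OF matrix_vector_bounded_linear(2)[THEN bounded_linear.linear] i_smult_linear]
    by (simp add: o_def linear_conv_bounded_linear)
  then have "bounded_linear (\<lambda>x. (- (1/2)) *\<^sub>R (\<i> *s (\<sigma> *v (x :: complex^'n))))"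
    by (rule bounded_linear_compose[OF bounded_linear_scaleR_right])
  then show ?thesis
    by (rule bounded_bilinear.comp1[OF bounded_bilinear_inner])
qed

lemma hamiltonian_smooth: "smooth_on UNIV (hamiltonian \<sigma>)"
  using Ck_on_quadratic[OF hamiltonian_bilinear[of \<sigma>]]
  unfolding hamiltonian_eq[abs_def] by (simp add: smooth_on_UNIV_iff)

text \<open>
  Skewness of \<open>\<sigma>\<close>, polarized at \<open>v + \<i> z\<close>, makes the two terms of the product rule equal.
\<close>

lemma hamiltonian_derivative:
  assumes skew: "\<And>x. x \<bullet> (\<sigma> *v x) = 0"
  shows "frechet_derivative (hamiltonian \<sigma>) (at z) v = - Omega0 (\<sigma> *v z) v"
proof -
  have "(hamiltonian \<sigma> has_derivative (\<lambda>v. ((- (1/2)) *\<^sub>R (\<i> *s (\<sigma> *v z))) \<bullet> v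
      + ((- (1/2)) *\<^sub>R (\<i> *s (\<sigma> *v v))) \<bullet> z)) (at z)"
    unfolding hamiltonian_eq[abs_def]
    by (rule bounded_bilinear.FDERIV[OF hamiltonian_bilinear]) (auto intro: derivative_intros)
  then have "frechet_derivative (hamiltonian \<sigma>) (at z) v
      = - (1/2) * ((\<i> *s (\<sigma> *v z)) \<bullet> v) - (1/2) * ((\<i> *s (\<sigma> *v v)) \<bullet> z)"
    by (subst frechet_derivative_at[symmetric]) auto
  moreover have "(\<i> *s (\<sigma> *v v)) \<bullet> z = (\<i> *s (\<sigma> *v z)) \<bullet> v"
  proof -
    have "(v + \<i> *s z) \<bullet> (\<sigma> *v (v + \<i> *s z)) = 0" by (rule skew)
    then have "v \<bullet> (\<sigma> *v (\<i> *s z)) + (\<i> *s z) \<bullet> (\<sigma> *v v) = 0"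
      using skew[of v] skew[of "\<i> *s z"]
      by (simp add: matrix_vector_right_distrib inner_add_left inner_add_right)
    then show ?thesis
      using inner_i_smult_left[of "\<sigma> *v z" v] inner_i_smult_left[of z "\<sigma> *v v"]
        inner_i_smult_left[of "\<sigma> *v v" z]
      by (simp add: vector_scalar_commute inner_commute)
  qed
  ultimately show ?thesis by (simp add: Omega0_apply)
qed

definition hamiltonian_CP :: "complex^'n^'n \<Rightarrow> (complex^'n) set \<Rightarrow> real" where
  "hamiltonian_CP \<sigma> orb = hamiltonian \<sigma> (SOME z. z \<in> orb)"

lemma hamiltonian_CP_orbit [simp]: "hamiltonian_CP \<sigma> (orbit_of CP z) = hamiltonian \<sigma> z"
proof -
  have "1 *s z \<in> orbit_of CP z"
    unfolding orbit_of_def by (auto intro!: image_eqI[where x = "\<lambda>w. 1 *s w"] exI[of _ 1])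
  then have "(SOME w. w \<in> orbit_of CP z) \<in> orbit_of CP z" by (rule someI)
  then show ?thesis
    unfolding hamiltonian_CP_def by (auto simp: orbit_of_def hamiltonian_smult)
qed

lemma hamiltonian_lifts: "lifts CP (hamiltonian_CP \<sigma>) (hamiltonian \<sigma>)"
  using hamiltonian_smooth by (auto simp: lifts_def intro!: exI[of _ UNIV])

lemma moment_map_hamiltonian:
  fixes label :: "'n::finite \<Rightarrow> nat"
  shows "moment_map CP fubini_study (unitary_block label k) hamiltonian_CP"
  unfolding moment_map_def
proof (intro conjI ballI allI)
  fix \<sigma> \<tau> :: "complex^'n^'n" and s t :: real and z :: "complex^'n"
  have "hamiltonian (s *\<^sub>R \<sigma> + t *\<^sub>R \<tau>) z = s * hamiltonian \<sigma> z + t * hamiltonian \<tau> z"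
    unfolding hamiltonian_def
    by (simp add: linear_add[OF bounded_linear.linear[OF matrix_vector_bounded_linear(1)]]
       linear_cmul[OF bounded_linear.linear[OF matrix_vector_bounded_linear(1)]] i_smult_simps
       inner_add_left field_simps)
  then show "hamiltonian_CP (s *\<^sub>R \<sigma> + t *\<^sub>R \<tau>) (orbit_of CP z)
      = s * hamiltonian_CP \<sigma> (orbit_of CP z) + t * hamiltonian_CP \<tau> (orbit_of CP z)"
    by simp
next
  fix \<sigma> :: "complex^'n^'n" assume \<sigma>: "\<sigma> \<in> lie_alg (unitary_block label k)"
  show "smooth_fun CP (hamiltonian_CP \<sigma>)"
    using hamiltonian_lifts unfolding smooth_fun_def by blast
  fix z v :: "complex^'n" assume "z \<in> pts CP" "v \<in> tang CP z"
  then show "fubini_study z (\<sigma> *v z) v = - dfun CP (hamiltonian_CP \<sigma>) z v"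
    by (simp add: fubini_study_def dfun_CP[OF hamiltonian_lifts]
        hamiltonian_derivative[OF lie_alg_unitary_block(2)[OF \<sigma>]])
qed

lemma equivariant_hamiltonian:
  fixes label :: "'n::finite \<Rightarrow> nat"
  shows "equivariant_map CP (unitary_block label k) hamiltonian_CP"
  unfolding equivariant_map_def
proof (intro ballI)
  fix A \<sigma> and z :: "complex^'n" assume A: "A \<in> unitary_block label k"
  have "hamiltonian (A ** \<sigma> ** matrix_inv A) (A *v z) = - (1/2) * ((A *v (\<i> *s (\<sigma> *v z))) \<bullet> (A *v z))"
    by (simp add: hamiltonian_def matrix_vector_mul_assoc[symmetric] unitary_block_inv(4)[OF A]
        vector_scalar_commute)
  then show "hamiltonian_CP (A ** \<sigma> ** matrix_inv A) (orbit_of CP (A *v z)) = hamiltonian_CP \<sigma> (orbit_of CP z)"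
    by (simp add: unitary_block_inner[OF A] hamiltonian_def)
qed

section \<open>The action on projective space\<close>

context toric
begin

lemma block_id:
  assumes "\<And>i. label i < k \<Longrightarrow> w $ i = 0"
  shows "block w = w"
  using assms by (auto simp: block_def vec_eq_iff not_le)

lemma block_component: "label i < k \<Longrightarrow> block w $ i = 0"
  by (simp add: block_def)

lemma inner_block: "block x \<bullet> y = block x \<bullet> block y"
  by (simp add: inner_vec_def block_def if_distrib[of "\<lambda>a. a \<bullet> _"] if_distrib[of "\<lambda>a. _ \<bullet> a"] cong: if_cong)

lemma unitary_block_fixes:
  assumes A: "A \<in> unitary_block label k"
  shows "label i < k \<Longrightarrow> (A *v x) $ i = x $ i" and "block x = 0 \<Longrightarrow> A *v x = x"
proof -
  show "(A *v x) $ i = x $ i" if "label i < k"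
  proof -
    have "A $ i $ j = (if i = j then 1 else 0)" for j using A that unfolding unitary_block_iff by blast
    then have "(A *v x) $ i = (\<Sum>j\<in>UNIV. (if i = j then 1 else 0) * x $ j)"
      unfolding matrix_vector_mult_def by simp
    also have "\<dots> = x $ i" by (simp add: if_distrib[of "\<lambda>a. a * _"] cong: if_cong)
    finally show ?thesis .
  qed
  assume x: "block x = 0"
  have "A $ i $ j * x $ j = (if i = j then x $ j else 0)" for i j
  proof (cases "label j < k")
    case True
    then have "A $ i $ j = (if i = j then 1 else 0)" using A unfolding unitary_block_iff by blast
    then show ?thesis by simp
  next
    case False
    moreover have "block x $ j = 0" using x by simp
    ultimately show ?thesis by (simp add: block_def)
  qed
  then show "A *v x = x" by (simp add: matrix_vector_mult_def vec_eq_iff)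
qed

text \<open>
  \<open>A\<close> does not change the coordinates on which \<open>J\<close> depends.  It acts within the block, where \<open>J\<close> is \<open>\<i>\<close>,
  and trivially on the complementary factor, which \<open>J\<close> preserves.
\<close>

lemma J_equivariant:
  assumes k: "0 < k" and A: "A \<in> unitary_block label k"
  shows "J (A *v z) (A *v v) = A *v J z v"
proof -
  have "J (A *v z) = J z" using J_cong[OF k] unitary_block_fixes(1)[OF A] by blast
  moreover have "J z (A *v v) = A *v J z v"
  proof -
    define u where "u = v - block v"
    have u: "block u = 0"
      by (simp add: u_def linear_diff[OF block_linear] block_id block_component)
    have "block (A *v block v) = A *v block v"
      by (rule block_id) (simp add: unitary_block_fixes(1)[OF A] block_component)
    then have "J z (A *v block v) = A *v J z (block v)"
      using J_block[OF k, of z "A *v block v"] J_block[OF k, of z v] by (simp add: vector_scalar_commute)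
    moreover have "block (J z u) = 0" using block_J[OF k, of z u] u by simp
    then have "J z (A *v u) = A *v J z u" using unitary_block_fixes(2)[OF A] u by simp
    ultimately have "J z (A *v (u + block v)) = A *v J z (u + block v)"
      by (simp add: matrix_vector_right_distrib blinfun.add_right)
    then show ?thesis by (simp add: u_def)
  qed
  ultimately show ?thesis by simp
qed

context
  fixes I :: "complex^'n \<Rightarrow> (complex^'n) \<Rightarrow>\<^sub>L (complex^'n)"
  assumes k: "0 < k" and red: "gk_reduction J I"
begin

lemma tamed_I: "norm z = 1 \<Longrightarrow> tamed_quotient {v. z \<bullet> v = 0} (span {\<i> *s z}) Omega0 (I z)"
  using red by (intro tamed_CP) (auto simp: gk_reduction_def)

text \<open>
  By unitarity and equivariance of \<open>J\<close>, the matrix \<open>A\<close> maps horizontal vectors at \<open>z\<close> to horizontal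
  vectors at \<open>A z\<close>; on these \<open>I\<close> is \<open>J\<close>.
\<close>

lemma I_preserved: "preserves_endo CP I (unitary_block label k)"
  unfolding preserves_endo_def CP_simps
proof (intro ballI)
  fix A z v assume A: "A \<in> unitary_block label k" and "z \<in> sphere (0::complex^'n) 1" "v \<in> {v. z \<bullet> v = 0}"
  then have z: "norm z = 1" and v: "z \<bullet> v = 0" by auto
  have Az: "norm (A *v z) = 1" by (simp add: unitary_block_norm[OF A] z)
  interpret at_z: tamed_quotient "{v. z \<bullet> v = 0}" "span {\<i> *s z}" Omega0 "I z" by (rule tamed_I[OF z])
  interpret at_Az: tamed_quotient "{v. (A *v z) \<bullet> v = 0}" "span {\<i> *s (A *v z)}" Omega0 "I (A *v z)"
    by (rule tamed_I[OF Az])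
  have A_vert: "A *v w \<in> span {\<i> *s (A *v z)}" if w: "w \<in> span {\<i> *s z}" for w
  proof -
    obtain t where "w = t *\<^sub>R (\<i> *s z)" using w by (auto simp: vert_CP_iff)
    then have "A *v w = t *\<^sub>R (\<i> *s (A *v z))"
      by (simp add: linear_cmul[OF bounded_linear.linear[OF matrix_vector_bounded_linear(2)]] vector_scalar_commute)
    then show ?thesis by (auto simp: vert_CP_iff)
  qed
  obtain h t where h: "v = h + t *\<^sub>R (\<i> *s z)" "z \<bullet> h = 0" "z \<bullet> J z h = 0"
    by (rule horizontal_decomposition[OF gk z v])
  let ?r = "t *\<^sub>R (\<i> *s z)"
  have r: "?r \<in> span {\<i> *s z}" by (simp add: span_base span_scale)
  have "I z h - J z h \<in> span {\<i> *s z}" by (rule gk_reduction_on_horizontal[OF gk red z h(2,3)])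
  then have 1: "A *v (I z h - J z h) \<in> span {\<i> *s (A *v z)}" by (rule A_vert)
  have 2: "I (A *v z) (A *v h) - J (A *v z) (A *v h) \<in> span {\<i> *s (A *v z)}"
    by (rule gk_reduction_on_horizontal[OF gk red Az])
       (simp_all add: J_equivariant[OF k A] unitary_block_inner[OF A] h)
  have 3: "I (A *v z) (A *v ?r) \<in> span {\<i> *s (A *v z)}" by (intro at_Az.J_R A_vert r)
  have 4: "A *v I z ?r \<in> span {\<i> *s (A *v z)}" by (intro at_z.J_R A_vert r)
  have "I (A *v z) (A *v v) - A *v I z v =
      (I (A *v z) (A *v h) - J (A *v z) (A *v h)) - A *v (I z h - J z h) + I (A *v z) (A *v ?r) - A *v I z ?r"
    unfolding h(1) J_equivariant[OF k A] blinfun.add_right matrix_vector_right_distrib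
      matrix_vector_mult_diff_distrib by simp
  also have "\<dots> \<in> span {\<i> *s (A *v z)}" by (intro at_Az.R_closed 1 2 3 4)
  finally show "I (A *v z) (A *v v) - A *v I z v \<in> span {\<i> *s (A *v z)}" .
qed

text \<open>
  Such a \<open>Y\<close> is horizontal, so \<open>I Y = J Y = \<i> Y\<close>.  That \<open>\<i> Y\<close> also satisfies the defining equation
  \<open>\<Omega>(I\<^sub>- Y, v) = - \<Omega>(Y, I v)\<close> is seen on the horizontal part of \<open>v\<close>, where \<open>I\<close> is \<open>J\<close> and the block
  component of \<open>J v\<close> is \<open>\<i>\<close> times that of \<open>v\<close>.
\<close>

lemma I_eq_Iminus_on_block:
  assumes z: "norm z = 1" and Y: "block Y = Y" "z \<bullet> Y = 0" "z \<bullet> (\<i> *s Y) = 0"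
  shows "I z Y - Jminus {v. z \<bullet> v = 0} Omega0 (I z) Y \<in> span {\<i> *s z}"
proof -
  interpret tamed_quotient "{v. z \<bullet> v = 0}" "span {\<i> *s z}" Omega0 "I z" by (rule tamed_I[OF z])
  have JY: "J z w = \<i> *s w" if "block w = w" for w using J_block[OF k, of z w] that by simp
  have iY: "block (\<i> *s Y) = \<i> *s Y" using block_J[OF k, of z Y] by (simp add: JY Y)
  have plus: "I z Y - \<i> *s Y \<in> span {\<i> *s z}"
    using gk_reduction_on_horizontal[OF gk red z Y(2)] Y by (simp add: JY)
  have "Jm Y - \<i> *s Y \<in> span {\<i> *s z}"
  proof (subst diff_in_R_iff, safe)
    show "z \<bullet> Jm Y = 0" using Jm_S[of Y] Y by simp
    show "z \<bullet> (\<i> *s Y) = 0" by (rule Y)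
    fix v assume v: "z \<bullet> v = 0"
    obtain h t where h: "v = h + t *\<^sub>R (\<i> *s z)" "z \<bullet> h = 0" "z \<bullet> J z h = 0"
      by (rule horizontal_decomposition[OF gk z v])
    let ?r = "t *\<^sub>R (\<i> *s z)"
    have "?r \<in> span {\<i> *s z}" by (simp add: span_base span_scale)
    then have "(I z h - J z h) + I z ?r \<in> span {\<i> *s z}"
      by (intro R_closed(1) J_R gk_reduction_on_horizontal[OF gk red z h(2,3)])
    then have "I z v - J z h \<in> span {\<i> *s z}" by (simp add: h(1) lin algebra_simps)
    then have "Omega0 Y (I z v) = Omega0 Y (J z h)" using \<Omega>_cong_R(2)[of _ _ Y] Y by simp
    also have "\<dots> = (\<i> *s Y) \<bullet> block (J z h)"
      using inner_block[of "\<i> *s Y" "J z h"] by (simp add: Omega0_apply iY)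
    also have "\<dots> = Y \<bullet> h" using inner_block[of Y h] by (simp add: block_J[OF k] Y)
    also have "\<dots> = Y \<bullet> v" using inner_i_smult_left[of Y z] Y by (simp add: h(1) inner_add_right inner_commute)
    finally show "Omega0 (Jm Y) v = Omega0 (\<i> *s Y) v"
      using \<Omega>_Jm[of Y v] Y v by (simp add: Omega0_apply)
  qed
  from R_closed(2)[OF plus this] show ?thesis by simp
qed

text \<open>
  Split off from \<open>u\<close> and \<open>u'\<close> their components along \<open>\<i> w\<close>, where \<open>w\<close> is the block component of \<open>z\<close>.
  What is left lies in the block and is orthogonal to \<open>z\<close> and to \<open>\<i> w\<close>, hence complex orthogonal to \<open>z\<close>.
\<close>

lemma poisson1_I_eq_0:
  assumes z: "norm z = 1"
    and u: "block u = u" "z \<bullet> u = 0" and u': "block u' = u'" "z \<bullet> u' = 0"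
    and \<alpha>: "\<And>y. z \<bullet> y = 0 \<Longrightarrow> blinfun_apply \<alpha> y = - Omega0 u y"
    and \<gamma>: "\<And>y. z \<bullet> y = 0 \<Longrightarrow> blinfun_apply \<gamma> y = - Omega0 u' y"
  shows "poisson1 {v. z \<bullet> v = 0} Omega0 (I z) \<alpha> \<gamma> = 0"
proof -
  interpret tamed_quotient "{v. z \<bullet> v = 0}" "span {\<i> *s z}" Omega0 "I z" by (rule tamed_I[OF z])
  define w where "w = block z"
  \<comment> \<open>If \<open>w = 0\<close> then \<open>e = 0\<close> and the coefficient \<open>r u\<close> is \<open>0 / 0 = 0\<close>; the decomposition still holds.\<close>
  define e where "e = \<i> *s w"
  define r where "r u = (u \<bullet> e) / (e \<bullet> e)" for u
  have w: "block w = w" by (simp add: w_def block_id block_component)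
  then have e: "block e = e" using block_J[OF k, of z w] J_block[OF k, of z w] by (simp add: e_def)
  have inner_w: "z \<bullet> x = w \<bullet> x" if "block x = x" for x
    using inner_block[of x z] that by (simp add: w_def inner_commute)
  have e_S: "z \<bullet> e = 0" using inner_w[OF e] by (simp add: e_def)
  have Y: "block (u - r u *\<^sub>R e) = u - r u *\<^sub>R e" "z \<bullet> (u - r u *\<^sub>R e) = 0" "z \<bullet> (\<i> *s (u - r u *\<^sub>R e)) = 0"
    if u: "block u = u" "z \<bullet> u = 0" for u
  proof -
    show b: "block (u - r u *\<^sub>R e) = u - r u *\<^sub>R e"
      by (simp add: linear_diff[OF block_linear] linear_cmul[OF block_linear] u e)
    show "z \<bullet> (u - r u *\<^sub>R e) = 0" by (simp add: inner_diff_right u e_S)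
    have "block (\<i> *s (u - r u *\<^sub>R e)) = \<i> *s (u - r u *\<^sub>R e)"
      using block_J[OF k, of z "u - r u *\<^sub>R e"] J_block[OF k, of z "u - r u *\<^sub>R e"] b by simp
    then have "z \<bullet> (\<i> *s (u - r u *\<^sub>R e)) = - (e \<bullet> (u - r u *\<^sub>R e))"
      by (simp add: inner_w inner_i_smult_left e_def)
    also have "\<dots> = 0" by (simp add: r_def inner_diff_right inner_commute)
    finally show "z \<bullet> (\<i> *s (u - r u *\<^sub>R e)) = 0" .
  qed
  show ?thesis
    using e_S Y[OF u] Y[OF u'] I_eq_Iminus_on_block[OF z] \<alpha> \<gamma>
    by (intro poisson1_eq_0[of e "u - r u *\<^sub>R e" "u' - r u' *\<^sub>R e" _ "r u" _ "r u'"]) auto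
qed

lemma I_strong_hamiltonian: "strong_hamiltonian CP fubini_study I (unitary_block label k)"
  unfolding strong_hamiltonian_def
proof (intro conjI allI impI ballI)
  show "\<exists>\<mu>. moment_map CP fubini_study (unitary_block label k) \<mu> \<and> equivariant_map CP (unitary_block label k) \<mu>"
    using moment_map_hamiltonian equivariant_hamiltonian by blast
  fix \<mu> \<sigma> \<tau> z
  assume \<mu>: "moment_map CP fubini_study (unitary_block label k) \<mu>"
    and \<sigma>: "\<sigma> \<in> lie_alg (unitary_block label k)" and \<tau>: "\<tau> \<in> lie_alg (unitary_block label k)"
    and z: "z \<in> pts (CP :: (complex^'n) qman)"
  have d\<mu>: "dfun CP (\<mu> \<rho>) z y = - Omega0 (\<rho> *v z) y"
    if "\<rho> \<in> lie_alg (unitary_block label k)" "z \<bullet> y = 0" for \<rho> y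
    using \<mu> z that by (simp add: moment_map_def fubini_study_def)
  have generated: "block (\<rho> *v z) = \<rho> *v z" "z \<bullet> (\<rho> *v z) = 0"
    if "\<rho> \<in> lie_alg (unitary_block label k)" for \<rho>
    using lie_alg_unitary_block[OF that] by (auto intro: block_id)
  have "fubini_study z = Omega0" by (simp add: fubini_study_def fun_eq_iff)
  then show "poisson1 (tang CP z) (fubini_study z) (I z) (dfun CP (\<mu> \<sigma>) z) (dfun CP (\<mu> \<tau>) z) = 0"
    using poisson1_I_eq_0[OF _ generated[OF \<sigma>] generated[OF \<tau>] d\<mu>[OF \<sigma>] d\<mu>[OF \<tau>]] z by simp
qed (rule compact_unitary_block acts_on_CP I_preserved)+

end

end

theorem proposition5p4:
  fixes label :: "'n::finite \<Rightarrow> nat" and n k :: nat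
    and c :: "nat \<Rightarrow> nat \<Rightarrow> real"
    and J I :: "complex^'n \<Rightarrow> (complex^'n) \<Rightarrow>\<^sub>L (complex^'n)"
  assumes "bij_betw label UNIV {0..n}"
    and "0 < k" and "k < n"
    and "\<forall>l\<in>{1..k-1}. \<forall>j\<in>{1..k-1}. c l j = - c j l"
    and "toric_gk label k c J"
    and "gk_reduction J I"
  shows "strong_hamiltonian CP fubini_study I (unitary_block label k)"
proof -
  interpret toric label k c J by (rule toric.intro) (rule assms(5))
  show ?thesis using assms(2,6) by (rule I_strong_hamiltonian)
qed

end
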